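(* For the magnetic topological subsystem with fixed initial flux $c_B(0)=c_{B,0}$, $$M_B^H\dot c_B=G_Ba_B+g_B,$$ the terminal period $c_{B,T}$ is reachable (at time $T$) if and only if $$M_B^H(c_{B,T}-c_{B,0})-\int_0^Tg_B(t)\,dt\in\operatorname{range}(G_B).$$ The analogous statement holds for $c_E$ after including the prescribed and distributed harmonic-current contributions in $$M_E^H\dot c_E=-j_H-C_Ez+G_Ea_E+g_E .$$ Thus the Betti numbers determine the dimensions of the topological state spaces, while the actuator ranks determine the number of independently reachable global modes.
   Context: Let $T>0$. On a bounded Lipschitz domain $\Omega\subset\mathbb R^3$ with uniformly positive definite material tensors $\varepsilon,\mu$, let $\mathfrak H^1_\varepsilon$ and $\mathfrak H^2_{\mu^{-1}}$ be the weighted harmonic spaces of the absolute de Rham complex at degrees one and two (closed fields orthogonal, in the $\varepsilon$- resp. $\mu^{-1}$-weighted $L^2$ inner product, to the exact fields). Their dimensions are the Betti numbers $b_1,b_2$. Let $H_E:\mathbb R^{b_1}\to\mathfrak H^1_\varepsilon$ and $H_B:\mathbb R^{b_2}\to\mathfrak H^2_{\mu^{-1}}$ be the reconstruction isomorphisms, i.e. the inverses of the chosen period maps. The harmonic mass matrices $M_E^H=H_E^*\varepsilon H_E\in\mathbb R^{b_1\times b_1}$ and $M_B^H=H_B^*\mu^{-1}H_B\in\mathbb R^{b_2\times b_2}$ are symmetric positive definite. The vectors $c_E(t)\in\mathbb R^{b_1}$ and $c_B(t)\in\mathbb R^{b_2}$ are the period coordinates (electric circulation and magnetic flux) of the harmonic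 parts of the electric and magnetic fields; they are the topological states. Here $a_E(t)\in\mathbb R^{m_E}$ and $a_B(t)\in\mathbb R^{m_B}$ are finite-dimensional topological actuators (controls, in $L^2$ in time), $G_E\in\mathbb R^{b_1\times m_E}$ and $G_B\in\mathbb R^{b_2\times m_B}$ are the actuator matrices, and $g_E,g_B$ are prescribed topological forcings. The total current is $j+\mathcal Bz$, where $j$ is prescribed, $z$ is the distributed control and $\mathcal B$ is the distributed-current control operator; $j_H(t)=H_E^*j(t)$ is the prescribed harmonic current and $C_Ez=H_E^*\mathcal Bz$ the distributed harmonic-current contribution. A terminal period $c_{B,T}\in\mathbb R^{b_2}$ is reachable if some control $a_B\in L^2(0,T;\mathbb R^{m_B})$ gives a solution with $c_B(0)=c_{B,0}$ and $c_B(T)=c_{B,T}$. *)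

theory Defs
  imports
    "HOL-Analysis.Analysis"
    "HOL-Homology.Homology"
    "Jordan_Normal_Form.DL_Rank"
begin

text \<open>Points and fields on the domain use the Cartesian types \<open>real^3\<close>, \<open>real^3^3\<close>.  Period vectors,
  actuator matrices and harmonic mass matrices use the dimension-carrying \<open>real vec\<close> and
  \<open>real mat\<close> of Jordan Normal Form, because Betti numbers and actuator counts may be 0.  The infix
  \<open>$\<close> and the bullet below are the Cartesian ones.\<close>

no_notation vec_index (infixl \<open>$\<close> 100)
no_notation scalar_prod (infix \<open>\<bullet>\<close> 70)


section \<open>Domain, Betti numbers, material tensors\<close>

definition lipschitz_domain :: "(real^3) set \<Rightarrow> bool" where
  "lipschitz_domain \<Omega> \<longleftrightarrow>
     open \<Omega> \<and> connected \<Omega> \<and> \<Omega> \<noteq> {} \<and>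
     (\<forall>p \<in> frontier \<Omega>. \<exists>r > 0. \<exists>(R :: real^3 \<Rightarrow> real^3) (\<gamma> :: real^2 \<Rightarrow> real) L.
        orthogonal_transformation R \<and> L-lipschitz_on UNIV \<gamma> \<and>
        (\<forall>x \<in> ball p r. x \<in> \<Omega> \<longleftrightarrow> \<gamma> (vector [R x $ 1, R x $ 2]) < R x $ 3))"

text \<open>Homology groups are written multiplicatively, so an integer linear combination of classes is a
  product of integer powers.\<close>

definition int_independent :: "('a, 'm) monoid_scheme \<Rightarrow> 'a set \<Rightarrow> bool" where
  "int_independent G S \<longleftrightarrow> finite S \<and> S \<subseteq> carrier G \<and>
     (\<forall>m :: 'a \<Rightarrow> int. finprod G (\<lambda>s. s [^]\<^bsub>G\<^esub> m s) S = \<one>\<^bsub>G\<^esub> \<longrightarrow> (\<forall>s \<in> S. m s = 0))"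

text \<open>The free rank of the integral singular homology group.  The maximum exists on bounded Lipschitz
  domains, whose homology is finitely generated.\<close>

definition betti :: "int \<Rightarrow> (real^3) set \<Rightarrow> nat" where
  "betti k \<Omega> =
     (GREATEST n. \<exists>S. int_independent (homology_group k (top_of_set \<Omega>)) S \<and> card S = n)"

definition material_tensor :: "(real^3) set \<Rightarrow> (real^3 \<Rightarrow> real^3^3) \<Rightarrow> bool" where
  "material_tensor \<Omega> w \<longleftrightarrow>
     w \<in> borel_measurable (lebesgue_on \<Omega>) \<and>
     (\<exists>\<alpha> > 0. \<exists>\<beta>. AE x in lebesgue_on \<Omega>.
        transpose (w x) = w x \<and>
        (\<forall>\<xi>. \<alpha> * (norm \<xi>)\<^sup>2 \<le> (w x *v \<xi>) \<bullet> \<xi>) \<and>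
        (\<forall>\<xi>. norm (w x *v \<xi>) \<le> \<beta> * norm \<xi>))"


section \<open>Weak differential operators\<close>

definition L2 :: "'a::euclidean_space set \<Rightarrow> ('a \<Rightarrow> 'b::euclidean_space) \<Rightarrow> bool" where
  "L2 S F \<longleftrightarrow> F \<in> borel_measurable (lebesgue_on S) \<and>
     integrable (lebesgue_on S) (\<lambda>x. (norm (F x))\<^sup>2)"

definition partial :: "3 \<Rightarrow> (real^3 \<Rightarrow> real) \<Rightarrow> real^3 \<Rightarrow> real" where
  "partial i f x = frechet_derivative f (at x) (axis i 1)"

primrec Ck :: "nat \<Rightarrow> (real^3 \<Rightarrow> real) \<Rightarrow> bool" where
  "Ck 0 f \<longleftrightarrow> continuous_on UNIV f"
| "Ck (Suc k) f \<longleftrightarrow> (\<forall>x. f differentiable (at x)) \<and> (\<forall>i. Ck k (partial i f))"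

definition test_function :: "(real^3) set \<Rightarrow> (real^3 \<Rightarrow> real) \<Rightarrow> bool" where
  "test_function \<Omega> \<psi> \<longleftrightarrow> (\<forall>k. Ck k \<psi>) \<and>
     compact (closure {x. \<psi> x \<noteq> 0}) \<and> closure {x. \<psi> x \<noteq> 0} \<subseteq> \<Omega>"

definition grad :: "(real^3 \<Rightarrow> real) \<Rightarrow> real^3 \<Rightarrow> real^3" where
  "grad \<psi> x = (\<chi> i. partial i \<psi> x)"

definition curl :: "(real^3 \<Rightarrow> real^3) \<Rightarrow> real^3 \<Rightarrow> real^3" where
  "curl \<Psi> x = vector
     [partial 2 (\<lambda>y. \<Psi> y $ 3) x - partial 3 (\<lambda>y. \<Psi> y $ 2) x,
      partial 3 (\<lambda>y. \<Psi> y $ 1) x - partial 1 (\<lambda>y. \<Psi> y $ 3) x,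
      partial 1 (\<lambda>y. \<Psi> y $ 2) x - partial 2 (\<lambda>y. \<Psi> y $ 1) x]"

definition weak_grad :: "(real^3) set \<Rightarrow> (real^3 \<Rightarrow> real) \<Rightarrow> (real^3 \<Rightarrow> real^3) \<Rightarrow> bool" where
  "weak_grad \<Omega> \<phi> G \<longleftrightarrow> (\<forall>\<psi> i. test_function \<Omega> \<psi> \<longrightarrow>
     (LINT x|lebesgue_on \<Omega>. \<phi> x * partial i \<psi> x) = - (LINT x|lebesgue_on \<Omega>. G x $ i * \<psi> x))"

definition weak_curl :: "(real^3) set \<Rightarrow> (real^3 \<Rightarrow> real^3) \<Rightarrow> (real^3 \<Rightarrow> real^3) \<Rightarrow> bool" where
  "weak_curl \<Omega> A C \<longleftrightarrow> (\<forall>\<Psi>. (\<forall>i. test_function \<Omega> (\<lambda>x. \<Psi> x $ i)) \<longrightarrow>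
     (LINT x|lebesgue_on \<Omega>. A x \<bullet> curl \<Psi> x) = (LINT x|lebesgue_on \<Omega>. C x \<bullet> \<Psi> x))"

definition weak_div :: "(real^3) set \<Rightarrow> (real^3 \<Rightarrow> real^3) \<Rightarrow> (real^3 \<Rightarrow> real) \<Rightarrow> bool" where
  "weak_div \<Omega> F d \<longleftrightarrow> (\<forall>\<psi>. test_function \<Omega> \<psi> \<longrightarrow>
     (LINT x|lebesgue_on \<Omega>. F x \<bullet> grad \<psi> x) = - (LINT x|lebesgue_on \<Omega>. d x * \<psi> x))"


section \<open>Weighted harmonic spaces of the absolute de Rham complex\<close>

definition weighted_inner ::
  "(real^3) set \<Rightarrow> (real^3 \<Rightarrow> real^3^3) \<Rightarrow> (real^3 \<Rightarrow> real^3) \<Rightarrow> (real^3 \<Rightarrow> real^3) \<Rightarrow> real" where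
  "weighted_inner \<Omega> w F G = (LINT x|lebesgue_on \<Omega>. (w x *v F x) \<bullet> G x)"

text \<open>No boundary condition is imposed on closed or exact fields: the potentials range over all of
  \<open>H\<^sup>1\<close> and \<open>H(curl)\<close>.  Elements are functions, to be read modulo equality almost everywhere.\<close>

definition harmonic1 :: "(real^3) set \<Rightarrow> (real^3 \<Rightarrow> real^3^3) \<Rightarrow> (real^3 \<Rightarrow> real^3) set" where
  "harmonic1 \<Omega> w = {E. L2 \<Omega> E \<and> weak_curl \<Omega> E (\<lambda>x. 0) \<and>
     (\<forall>\<phi> G. L2 \<Omega> \<phi> \<and> L2 \<Omega> G \<and> weak_grad \<Omega> \<phi> G \<longrightarrow> weighted_inner \<Omega> w E G = 0)}"

definition harmonic2 :: "(real^3) set \<Rightarrow> (real^3 \<Rightarrow> real^3^3) \<Rightarrow> (real^3 \<Rightarrow> real^3) set" where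
  "harmonic2 \<Omega> w = {F. L2 \<Omega> F \<and> weak_div \<Omega> F (\<lambda>x. 0) \<and>
     (\<forall>A C. L2 \<Omega> A \<and> L2 \<Omega> C \<and> weak_curl \<Omega> A C \<longrightarrow> weighted_inner \<Omega> w F C = 0)}"

text \<open>A choice of period map is a linear isomorphism from a harmonic space, taken modulo equality
  almost everywhere, onto the space of period vectors.\<close>

definition period_map ::
  "(real^3) set \<Rightarrow> (real^3 \<Rightarrow> real^3) set \<Rightarrow> nat \<Rightarrow> ((real^3 \<Rightarrow> real^3) \<Rightarrow> real vec) \<Rightarrow> bool" where
  "period_map \<Omega> V b P \<longleftrightarrow>
     P ` V = carrier_vec b \<and>
     (\<forall>F \<in> V. \<forall>G \<in> V. \<forall>r s :: real.
        P (\<lambda>x. r *\<^sub>R F x + s *\<^sub>R G x) = r \<cdot>\<^sub>v P F + s \<cdot>\<^sub>v P G) \<and>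
     (\<forall>F \<in> V. P F = 0\<^sub>v b \<longleftrightarrow> (AE x in lebesgue_on \<Omega>. F x = 0))"

text \<open>The inverse of a period map, with values determined almost everywhere.\<close>

definition reconstruction ::
  "(real^3 \<Rightarrow> real^3) set \<Rightarrow> nat \<Rightarrow> ((real^3 \<Rightarrow> real^3) \<Rightarrow> real vec)
     \<Rightarrow> (real vec \<Rightarrow> real^3 \<Rightarrow> real^3) \<Rightarrow> bool" where
  "reconstruction V b P H \<longleftrightarrow> (\<forall>c \<in> carrier_vec b. H c \<in> V \<and> P (H c) = c)"

text \<open>The adjoint \<open>H\<^sup>*\<close> with respect to the unweighted inner product on \<open>L\<^sup>2\<close> and the Euclidean one on
  period vectors.\<close>

definition recon_adjoint ::
  "(real^3) set \<Rightarrow> nat \<Rightarrow> (real vec \<Rightarrow> real^3 \<Rightarrow> real^3) \<Rightarrow> (real^3 \<Rightarrow> real^3) \<Rightarrow> real vec" where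
  "recon_adjoint \<Omega> b H F = Matrix.vec b (\<lambda>i. LINT x|lebesgue_on \<Omega>. F x \<bullet> H (unit_vec b i) x)"

text \<open>Column \<open>j\<close> of \<open>H\<^sup>* w H\<close> is \<open>H\<^sup>* w H e\<^sub>j\<close>.\<close>

definition harmonic_mass ::
  "(real^3) set \<Rightarrow> (real^3 \<Rightarrow> real^3^3) \<Rightarrow> nat \<Rightarrow> (real vec \<Rightarrow> real^3 \<Rightarrow> real^3) \<Rightarrow> real mat" where
  "harmonic_mass \<Omega> w b H = Matrix.mat b b
     (\<lambda>(i, j). vec_index (recon_adjoint \<Omega> b H (\<lambda>x. w x *v H (unit_vec b j) x)) i)"


section \<open>Time-dependent data, distributed control\<close>

definition L1_time :: "real \<Rightarrow> nat \<Rightarrow> (real \<Rightarrow> real vec) \<Rightarrow> bool" where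
  "L1_time T n f \<longleftrightarrow> (\<forall>t. f t \<in> carrier_vec n) \<and>
     (\<forall>i < n. integrable (lebesgue_on {0..T}) (\<lambda>t. vec_index (f t) i))"

definition L2_time :: "real \<Rightarrow> nat \<Rightarrow> (real \<Rightarrow> real vec) \<Rightarrow> bool" where
  "L2_time T n f \<longleftrightarrow> (\<forall>t. f t \<in> carrier_vec n) \<and>
     (\<forall>i < n. L2 {0..T} (\<lambda>t. vec_index (f t) i))"

definition time_integral :: "real \<Rightarrow> nat \<Rightarrow> (real \<Rightarrow> real vec) \<Rightarrow> real vec" where
  "time_integral T n f = Matrix.vec n (\<lambda>i. LINT t|lebesgue_on {0..T}. vec_index (f t) i)"

text \<open>\<open>L\<^sup>2(0,T; L\<^sup>2(\<Omega>))\<close>, realized as \<open>L\<^sup>2\<close> of the space-time cylinder.\<close>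

definition L2_time_L2 :: "real \<Rightarrow> (real^3) set \<Rightarrow> (real \<Rightarrow> real^3 \<Rightarrow> real^3) \<Rightarrow> bool" where
  "L2_time_L2 T \<Omega> j \<longleftrightarrow>
     (\<lambda>(t, x). j t x) \<in> borel_measurable (lebesgue_on {0..T} \<Otimes>\<^sub>M lebesgue_on \<Omega>) \<and>
     integrable (lebesgue_on {0..T} \<Otimes>\<^sub>M lebesgue_on \<Omega>) (\<lambda>(t, x). (norm (j t x))\<^sup>2)"

text \<open>A bounded linear operator from the control space into \<open>L\<^sup>2(\<Omega>)\<close>.\<close>

definition distributed_control_operator ::
  "(real^3) set \<Rightarrow> ('z::{real_inner, complete_space} \<Rightarrow> real^3 \<Rightarrow> real^3) \<Rightarrow> bool" where
  "distributed_control_operator \<Omega> \<B> \<longleftrightarrow>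
     (\<forall>u. L2 \<Omega> (\<B> u)) \<and>
     (\<forall>u v. \<forall>r s :: real. AE x in lebesgue_on \<Omega>.
        \<B> (r *\<^sub>R u + s *\<^sub>R v) x = r *\<^sub>R \<B> u x + s *\<^sub>R \<B> v x) \<and>
     (\<exists>K. \<forall>u. (LINT x|lebesgue_on \<Omega>. (norm (\<B> u x))\<^sup>2) \<le> K * (norm u)\<^sup>2)"

definition distributed_control :: "real \<Rightarrow> (real \<Rightarrow> 'z::{real_inner, complete_space}) \<Rightarrow> bool" where
  "distributed_control T z \<longleftrightarrow> z \<in> borel_measurable (lebesgue_on {0..T}) \<and>
     integrable (lebesgue_on {0..T}) (\<lambda>t. (norm (z t))\<^sup>2)"


section \<open>Topological subsystems and reachability\<close>

definition absolutely_continuous_fn :: "real \<Rightarrow> (real \<Rightarrow> real) \<Rightarrow> bool" where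
  "absolutely_continuous_fn T f \<longleftrightarrow> (\<forall>e > 0. \<exists>d > 0. \<forall>D :: (real \<times> real) set.
     finite D \<and> (\<forall>(a, b) \<in> D. 0 \<le> a \<and> a \<le> b \<and> b \<le> T) \<and>
     disjoint_family_on (\<lambda>(a, b). {a<..<b}) D \<and> (\<Sum>(a, b) \<in> D. b - a) < d \<longrightarrow>
     (\<Sum>(a, b) \<in> D. \<bar>f b - f a\<bar>) < e)"

text \<open>\<open>c\<close> solves \<open>M c' = F\<close> on \<open>[0,T]\<close> in the sense of Caratheodory.\<close>

definition solves :: "real \<Rightarrow> nat \<Rightarrow> real mat \<Rightarrow> (real \<Rightarrow> real vec) \<Rightarrow> (real \<Rightarrow> real vec) \<Rightarrow> bool" where
  "solves T b M F c \<longleftrightarrow>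
     (\<forall>t \<in> {0..T}. c t \<in> carrier_vec b) \<and>
     (\<forall>i < b. absolutely_continuous_fn T (\<lambda>t. vec_index (c t) i)) \<and>
     (AE t in lebesgue_on {0..T}. \<exists>c' \<in> carrier_vec b.
        (\<forall>i < b. ((\<lambda>s. vec_index (c s) i) has_real_derivative vec_index c' i) (at t within {0..T})) \<and>
        M *\<^sub>v c' = F t)"

text \<open>The right-hand side \<open>F\<close> depends on the actuator control \<open>a\<close>, with \<open>m\<close> components.\<close>

definition reachable ::
  "real \<Rightarrow> nat \<Rightarrow> nat \<Rightarrow> real mat \<Rightarrow> ((real \<Rightarrow> real vec) \<Rightarrow> real \<Rightarrow> real vec)
     \<Rightarrow> real vec \<Rightarrow> real vec \<Rightarrow> bool" where
  "reachable T b m M F c0 cT \<longleftrightarrow>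
     (\<exists>a c. L2_time T m a \<and> solves T b M (F a) c \<and> c 0 = c0 \<and> c T = cT)"

definition mat_range :: "real mat \<Rightarrow> real vec set" where
  "mat_range G = (\<lambda>u. G *\<^sub>v u) ` carrier_vec (dim_col G)"

definition subspace_dim :: "nat \<Rightarrow> real vec set \<Rightarrow> nat" where
  "subspace_dim n W = vectorspace.dim class_ring ((module_vec TYPE(real) n)\<lparr>carrier := W\<rparr>)"

definition affine_subspace_of_dim :: "nat \<Rightarrow> real vec set \<Rightarrow> nat \<Rightarrow> bool" where
  "affine_subspace_of_dim n S d \<longleftrightarrow>
     (\<exists>p \<in> carrier_vec n. \<exists>W. VectorSpace.subspace class_ring W (module_vec TYPE(real) n) \<and>
        S = (\<lambda>w. p + w) ` W \<and> subspace_dim n W = d)"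

end

theory Submission
  imports Defs
begin

text \<open>Integrating \<open>M c' = G a + f\<close> over \<open>[0,T]\<close> gives \<open>M (c T - c 0) - \<integral>f = G (\<integral>a)\<close>, which lies in the range
  of \<open>G\<close>.  Conversely, if this vector is \<open>G u\<close>, the constant control \<open>u / T\<close> steers \<open>c 0\<close> to \<open>c T\<close>, because
  the mass matrix is invertible.  The reachable set is therefore a translate of \<open>M\<^sup>-\<^sup>1 (range G)\<close>, whose
  dimension is the rank of \<open>G\<close>.  The analytic inputs are the fundamental theorem of calculus for
  absolutely continuous functions, Lebesgue differentiation of indefinite integrals, and invertibility of
  the harmonic mass matrices: a period vector in the kernel is represented by a harmonic field of zero
  energy, so it vanishes.\<close>

section \<open>Square-integrable fields\<close>

text \<open>Three obstacles shape the argument. A solution is only absolutely continuous, so its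
  increment is first recovered as a Henstock-Kurzweil integral, where a gauge can treat the points
  without a derivative separately; the Lebesgue integral returns because the right-hand side is
  integrable. Harmonic fields are functions, but period maps see them only up to null sets, so
  \<open>H_E\<close> and \<open>H_B\<close> are linear only almost everywhere; energies are
  therefore computed from combinations of the reconstructed unit vectors. Finally, the magnetic
  weight is the pointwise inverse of \<open>\<mu>\<close>, which must itself be shown to be a
  material tensor, measurability included. The electric equation differs from the magnetic one by
  its forcing. Once the prescribed and the distributed current are known to have integrable period
  components, they merge with \<open>g_E\<close>, and one reachability criterion serves both
  subsystems. The state space dimensions come from surjectivity of the period maps onto vectors of
  Betti length.\<close>

lemma L2_imp_integrable:
  fixes f :: "'a::euclidean_space \<Rightarrow> 'b::euclidean_space"
  assumes f: "L2 S f" and S: "S \<in> lmeasurable"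
  shows "integrable (lebesgue_on S) f"
proof -
  have "integrable (lebesgue_on S) (\<lambda>x. 1 + (norm (f x))\<^sup>2)"
    using f finite_measure.integrable_const[OF finite_measure_lebesgue_on[OF S], of "1::real"]
    by (auto simp: L2_def)
  then show ?thesis
  proof (rule Bochner_Integration.integrable_bound)
    show "AE x in lebesgue_on S. norm (f x) \<le> norm (1 + (norm (f x))\<^sup>2)"
    proof (rule AE_I2)
      fix x
      have "0 \<le> (norm (f x) - 1)\<^sup>2" by simp
      then have "2 * norm (f x) \<le> 1 + (norm (f x))\<^sup>2" by (simp add: power2_diff)
      then show "norm (f x) \<le> norm (1 + (norm (f x))\<^sup>2)"
        using norm_ge_zero[of "f x"] unfolding real_norm_def by linarith
    qed
  qed (use f in \<open>simp add: L2_def\<close>)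
qed

lemma abs_inner_le_sum_squares:
  fixes x y :: "'a::real_inner"
  shows "\<bar>x \<bullet> y\<bar> \<le> (norm x)\<^sup>2 + (norm y)\<^sup>2"
proof -
  have "\<bar>x \<bullet> y\<bar> \<le> norm x * norm y" by (rule Cauchy_Schwarz_ineq2)
  moreover have "0 \<le> (norm x - norm y)\<^sup>2" by simp
  then have "2 * (norm x * norm y) \<le> (norm x)\<^sup>2 + (norm y)\<^sup>2"
    by (simp add: power2_diff)
  ultimately show ?thesis
    using mult_nonneg_nonneg[OF norm_ge_zero[of x] norm_ge_zero[of y]] by linarith
qed

lemma L2_integrable_inner:
  fixes f g :: "'a::euclidean_space \<Rightarrow> 'b::euclidean_space"
  assumes f: "L2 S f" and g: "L2 S g"
  shows "integrable (lebesgue_on S) (\<lambda>x. f x \<bullet> g x)"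
proof -
  have "integrable (lebesgue_on S) (\<lambda>x. (norm (f x))\<^sup>2 + (norm (g x))\<^sup>2)"
    using f g by (auto simp: L2_def)
  then show ?thesis
  proof (rule Bochner_Integration.integrable_bound)
    show "(\<lambda>x. f x \<bullet> g x) \<in> borel_measurable (lebesgue_on S)"
      using f g by (auto simp: L2_def intro: borel_measurable_inner)
    show "AE x in lebesgue_on S. norm (f x \<bullet> g x) \<le> norm ((norm (f x))\<^sup>2 + (norm (g x))\<^sup>2)"
      using abs_inner_le_sum_squares by (intro AE_I2) (simp add: order_trans[OF _ abs_ge_self])
  qed
qed

text \<open>This crude replacement for the Cauchy-Schwarz inequality suffices because it is used to
  bound a linear functional on unit vectors; homogeneity then does the rest.\<close>

lemma L2_abs_integral_inner_le:
  fixes f g :: "'a::euclidean_space \<Rightarrow> 'b::euclidean_space"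
  assumes f: "L2 S f" and g: "L2 S g"
  shows "\<bar>LINT x|lebesgue_on S. f x \<bullet> g x\<bar>
    \<le> (LINT x|lebesgue_on S. (norm (f x))\<^sup>2) + (LINT x|lebesgue_on S. (norm (g x))\<^sup>2)"
proof -
  have "\<bar>LINT x|lebesgue_on S. f x \<bullet> g x\<bar> \<le> (LINT x|lebesgue_on S. \<bar>f x \<bullet> g x\<bar>)"
    using integral_norm_bound[of "lebesgue_on S" "\<lambda>x. f x \<bullet> g x"] by simp
  also have "\<dots> \<le> (LINT x|lebesgue_on S. (norm (f x))\<^sup>2 + (norm (g x))\<^sup>2)"
  proof (rule integral_mono)
    show "\<bar>f x \<bullet> g x\<bar> \<le> (norm (f x))\<^sup>2 + (norm (g x))\<^sup>2" for x
      by (rule abs_inner_le_sum_squares)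
  qed (use f g L2_integrable_inner[OF f g] in \<open>auto simp: L2_def\<close>)
  also have "\<dots> = (LINT x|lebesgue_on S. (norm (f x))\<^sup>2) + (LINT x|lebesgue_on S. (norm (g x))\<^sup>2)"
    using f g by (simp add: L2_def)
  finally show ?thesis .
qed

lemma L2_bound:
  fixes f :: "'a::euclidean_space \<Rightarrow> 'b::euclidean_space" and g :: "'a \<Rightarrow> 'c::euclidean_space"
  assumes g: "L2 S g" and f: "f \<in> borel_measurable (lebesgue_on S)"
    and le: "AE x in lebesgue_on S. norm (f x) \<le> C * norm (g x)"
  shows "L2 S f"
  unfolding L2_def
proof
  have "integrable (lebesgue_on S) (\<lambda>x. C\<^sup>2 * (norm (g x))\<^sup>2)"
    using g by (simp add: L2_def)
  then show "integrable (lebesgue_on S) (\<lambda>x. (norm (f x))\<^sup>2)"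
  proof (rule Bochner_Integration.integrable_bound)
    show "AE x in lebesgue_on S. norm ((norm (f x))\<^sup>2) \<le> norm (C\<^sup>2 * (norm (g x))\<^sup>2)"
      using le
    proof eventually_elim
      case (elim x)
      then have "(norm (f x))\<^sup>2 \<le> (C * norm (g x))\<^sup>2" by (rule power_mono) simp
      then show ?case by (simp add: power_mult_distrib)
    qed
  qed (intro borel_measurable_power measurable_compose[OF f borel_measurable_norm])
qed (rule f)

lemma L2_scaleR:
  fixes f :: "'a::euclidean_space \<Rightarrow> 'b::euclidean_space"
  assumes "L2 S f"
  shows "L2 S (\<lambda>x. r *\<^sub>R f x)"
proof (rule L2_bound[OF assms])
  show "(\<lambda>x. r *\<^sub>R f x) \<in> borel_measurable (lebesgue_on S)"
    using assms by (intro borel_measurable_scaleR) (simp_all add: L2_def)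
  show "AE x in lebesgue_on S. norm (r *\<^sub>R f x) \<le> \<bar>r\<bar> * norm (f x)" by simp
qed

lemma L2_add:
  fixes f g :: "'a::euclidean_space \<Rightarrow> 'b::euclidean_space"
  assumes f: "L2 S f" and g: "L2 S g"
  shows "L2 S (\<lambda>x. f x + g x)"
  unfolding L2_def
proof
  have m[measurable]: "f \<in> borel_measurable (lebesgue_on S)" "g \<in> borel_measurable (lebesgue_on S)"
    using f g by (auto simp: L2_def)
  show "(\<lambda>x. f x + g x) \<in> borel_measurable (lebesgue_on S)" by measurable
  have "(\<lambda>x. (norm (f x + g x))\<^sup>2) = (\<lambda>x. (norm (f x))\<^sup>2 + 2 * (f x \<bullet> g x) + (norm (g x))\<^sup>2)"
    by (auto simp: power2_norm_eq_inner inner_add_left inner_add_right inner_commute)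
  then show "integrable (lebesgue_on S) (\<lambda>x. (norm (f x + g x))\<^sup>2)"
    using f g L2_integrable_inner[OF f g] by (simp add: L2_def)
qed

text \<open>Makes gradients and curls of test functions square-integrable, so that the integrals in
  the weak equations may be split by linearity.\<close>

lemma L2_continuous:
  fixes f :: "'a::euclidean_space \<Rightarrow> 'b::euclidean_space"
  assumes S: "S \<in> lmeasurable" "bounded S" and f: "continuous_on UNIV f"
  shows "L2 S f"
proof -
  have m: "f \<in> borel_measurable (lebesgue_on S)"
    using borel_measurable_continuous_onI[OF f]
    by (simp add: measurable_completion measurable_restrict_space1)
  have "compact (f ` closure S)"
    using S(2) f by (intro compact_continuous_image) (auto intro: continuous_on_subset)
  then obtain C where "\<forall>y\<in>f ` closure S. norm y \<le> C"
    using compact_imp_bounded bounded_iff by blast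
  then have C: "norm (f x) \<le> C" if "x \<in> S" for x
    using that closure_subset by blast
  have "L2 S (\<lambda>x. 1 :: real)"
    using finite_measure.integrable_const[OF finite_measure_lebesgue_on[OF S(1)]]
    by (simp add: L2_def)
  then show ?thesis
    by (rule L2_bound[OF _ m, of _ C]) (intro AE_I2, simp add: C)
qed

section \<open>Absolutely continuous functions\<close>

text \<open>The gauge separates two kinds of tags. Where \<open>f\<close> is differentiable, its
  increments are close to those predicted by \<open>g\<close>; the remaining tags form a null set,
  and absolute continuity makes the increments there small. The gauge integral allows this without
  prior integrability of \<open>g\<close>.\<close>

lemma absolutely_continuous_fn_has_integral:
  assumes T: "0 \<le> T" and ac: "absolutely_continuous_fn T f"
    and ae: "AE t in lebesgue_on {0..T}. (f has_real_derivative g t) (at t within {0..T})"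
  shows "(g has_integral f T - f 0) {0..T}"
proof -
  obtain N0 where N0: "N0 \<in> null_sets (lebesgue_on {0..T})"
    "{t \<in> space (lebesgue_on {0..T}). \<not> (f has_real_derivative g t) (at t within {0..T})} \<subseteq> N0"
    using ae unfolding eventually_ae_filter by blast
  then have negN: "negligible N0"
    by (simp add: negligible_iff_null_sets null_sets_restrict_space)
  have der: "(f has_real_derivative g t) (at t within {0..T})" if "t \<in> {0..T}" "t \<notin> N0" for t
    using N0(2) that by auto
  \<comment> \<open>With the value 0 on \<open>N0\<close>, an interval tagged there contributes to
    the Riemann sum error nothing but the increment of \<open>f\<close>.\<close>
  define h where "h t = (if t \<in> N0 then 0 else g t)" for t
  have "(h has_integral f T - f 0) (cbox 0 T)"
    unfolding has_integral
  proof (intro allI impI)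
    fix e :: real assume e: "e > 0"
    \<comment> \<open>The errors at differentiable tags add up to at most \<open>e' * T\<close>; the
      \<open>+ 1\<close> keeps the quotient defined for \<open>T = 0\<close> and the bound
      strict.\<close>
    define e' where "e' = e / (2 * (T + 1))"
    have e': "e' > 0" "e' * T < e / 2"
      using e T by (auto simp: e'_def field_simps)
    obtain d where d: "d > 0" and acd: "\<forall>D. finite D \<and> (\<forall>(a, b) \<in> D. 0 \<le> a \<and> a \<le> b \<and> b \<le> T) \<and>
       disjoint_family_on (\<lambda>(a, b). {a<..<b}) D \<and> (\<Sum>(a, b) \<in> D. b - a) < d \<longrightarrow>
       (\<Sum>(a, b) \<in> D. \<bar>f b - f a\<bar>) < e / 2"
      using ac[unfolded absolutely_continuous_fn_def, rule_format, OF half_gt_zero[OF e]] by blast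
    obtain U where U: "open U" "N0 \<subseteq> U" "U \<in> lmeasurable" "measure lebesgue U < d"
    proof -
      obtain U where U: "open U" "N0 \<subseteq> U" "U - N0 \<in> lmeasurable"
        "emeasure lebesgue (U - N0) < ennreal d"
        using sets_lebesgue_outer_open[of N0 d] negN d negligible_imp_sets by metis
      have "U \<in> lmeasurable"
        using U(2,3) negN
        by (metis Diff_partition fmeasurable.Un negligible_imp_measurable)
      moreover have "measure lebesgue U = measure lebesgue (U - N0)"
        using measure_Diff_null_set[of U lebesgue N0] U(1) negN calculation
        by (simp add: negligible_iff_null_sets fmeasurableD)
      moreover have "measure lebesgue (U - N0) < d"
        using U(3,4) d by (simp add: emeasure_eq_measure2 ennreal_less_iff)
      ultimately show ?thesis using that U by simp
    qed
    have "\<exists>r>0. \<forall>y\<in>{0..T}. \<bar>y - t\<bar> < r \<longrightarrow> \<bar>f y - f t - g t * (y - t)\<bar> \<le> e' * \<bar>y - t\<bar>"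
      if "t \<in> {0..T}" "t \<notin> N0" for t
      using der[OF that] e'(1)
      unfolding has_field_derivative_def has_derivative_within_alt real_norm_def by blast
    then obtain r where r: "\<And>t. t \<in> {0..T} \<Longrightarrow> t \<notin> N0 \<Longrightarrow> r t > 0"
      "\<And>t y. t \<in> {0..T} \<Longrightarrow> t \<notin> N0 \<Longrightarrow> y \<in> {0..T} \<Longrightarrow> \<bar>y - t\<bar> < r t \<Longrightarrow>
         \<bar>f y - f t - g t * (y - t)\<bar> \<le> e' * \<bar>y - t\<bar>"
      by metis
    \<comment> \<open>The increments over intervals tagged in \<open>N0\<close> are not controlled by a derivative; \<open>U\<close> keeps the total
      length of these intervals below \<open>d\<close>, so absolute continuity makes their sum small.\<close>
    define \<gamma> where "\<gamma> t = (if t \<in> N0 then U else if t \<in> {0..T} then ball t (r t) else UNIV)" for t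
    show "\<exists>\<gamma>. gauge \<gamma> \<and> (\<forall>D. D tagged_division_of cbox 0 T \<and> \<gamma> fine D \<longrightarrow>
          norm ((\<Sum>(x,k)\<in>D. measure lborel k *\<^sub>R h x) - (f T - f 0)) < e)"
    proof (intro exI[of _ \<gamma>] conjI allI impI)
      show "gauge \<gamma>"
        using U r(1) unfolding gauge_def \<gamma>_def by auto
    next
      fix D assume "D tagged_division_of cbox 0 T \<and> \<gamma> fine D"
      then have D: "D tagged_division_of cbox 0 T" and fine: "\<gamma> fine D" by auto
      have finD: "finite D" using D by blast
      have tel: "(\<Sum>(x,k)\<in>D. f (Sup k) - f (Inf k)) = f T - f 0"
        using additive_tagged_division_1[OF T, of D f] D by simp
      define q where "q = {(x,k) \<in> D. x \<in> N0}"
      have qD: "q \<subseteq> D" by (auto simp: q_def)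
      have finq: "finite q" using finD qD finite_subset by blast
      have "q tagged_partial_division_of cbox 0 T"
        by (rule tagged_partial_division_subset[OF conjunct1[OF D[unfolded tagged_division_of_def]] qD])
      then have q: "q tagged_division_of \<Union>(snd ` q)"
        and qdiv: "snd ` q division_of \<Union>(snd ` q)"
        by (rule tagged_partial_division_of_Union_self, rule partial_division_of_tagged_division)
      have ivl: "\<exists>a b. k = {a..b} \<and> a \<le> b \<and> 0 \<le> a \<and> b \<le> T \<and> a \<le> x \<and> x \<le> b" if "(x,k) \<in> D" for x k
        using tagged_division_ofD(2-4)[OF D that] by auto
      have "(\<Sum>(x,k)\<in>D. measure lborel k *\<^sub>R h x) - (f T - f 0)
          = (\<Sum>(x,k)\<in>D. measure lborel k * h x - (f (Sup k) - f (Inf k)))"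
        by (simp add: tel[symmetric] sum_subtractf split_def)
      also have "\<dots> = (\<Sum>(x,k)\<in>D - q. measure lborel k * h x - (f (Sup k) - f (Inf k)))
          + (\<Sum>(x,k)\<in>q. measure lborel k * h x - (f (Sup k) - f (Inf k)))"
        using sum.subset_diff[OF qD finD] .
      finally have split: "(\<Sum>(x,k)\<in>D. measure lborel k *\<^sub>R h x) - (f T - f 0) = \<dots>" .
      have "\<bar>\<Sum>(x,k)\<in>D - q. measure lborel k * h x - (f (Sup k) - f (Inf k))\<bar>
          \<le> (\<Sum>(x,k)\<in>D - q. e' * measure lborel k)"
      proof (rule sum_abs[THEN order_trans], rule sum_mono, clarsimp)
        fix x k assume xk: "(x,k) \<in> D" "(x,k) \<notin> q"
        then have xN: "x \<notin> N0" by (auto simp: q_def)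
        obtain a b where ab: "k = {a..b}" "a \<le> b" "0 \<le> a" "b \<le> T" "a \<le> x" "x \<le> b"
          using ivl[OF xk(1)] by blast
        have "k \<subseteq> ball x (r x)"
          using fineD[OF fine xk(1)] xN ab by (auto simp: \<gamma>_def)
        moreover have "a \<in> k" "b \<in> k" using ab by auto
        ultimately have "\<bar>a - x\<bar> < r x" "\<bar>b - x\<bar> < r x"
          by (auto simp: subset_iff dist_real_def abs_minus_commute)
        then have "\<bar>f a - f x - g x * (a - x)\<bar> \<le> e' * (x - a)" "\<bar>f b - f x - g x * (b - x)\<bar> \<le> e' * (b - x)"
          using r(2)[of x a] r(2)[of x b] ab xN by auto
        \<comment> \<open>Straddle estimate: the tag lies between \<open>a\<close> and
          \<open>b\<close>, so the one-sided errors \<open>e' * (x - a)\<close> and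
          \<open>e' * (b - x)\<close> add up to \<open>e' * (b - a)\<close>.\<close>
        then have "\<bar>(b - a) * g x - (f b - f a)\<bar> \<le> e' * (b - a)"
          by (simp add: algebra_simps abs_le_iff)
        then show "\<bar>measure lborel k * h x - (f (Sup k) - f (Inf k))\<bar> \<le> e' * measure lborel k"
          using ab xN by (simp add: h_def)
      qed
      also have "\<dots> \<le> (\<Sum>(x,k)\<in>D. e' * measure lborel k)"
        using finD e'(1) by (intro sum_mono2) auto
      also have "\<dots> = e' * T"
        using additive_content_tagged_division[OF D] T
        by (simp add: sum_distrib_left[symmetric] split_def)
      finally have 1: "\<bar>\<Sum>(x,k)\<in>D - q. measure lborel k * h x - (f (Sup k) - f (Inf k))\<bar> < e / 2"
        using e'(2) by simp
      \<comment> \<open>Tags are dropped and intervals become pairs of endpoints, the format in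
        which absolute continuity is stated.\<close>
      define E where "E = (\<lambda>k. (Inf k, Sup k)) ` snd ` q"
      have inj: "inj_on (\<lambda>k. (Inf k, Sup k)) (snd ` q)"
      proof (rule inj_onI, clarsimp)
        fix k l x y assume xk: "(x,k) \<in> q" "(y,l) \<in> q" and eq: "Inf k = Inf l" "Sup k = Sup l"
        obtain a b where "k = {a..b}" "a \<le> b" using ivl[of x k] xk(1) qD by blast
        moreover obtain a' b' where "l = {a'..b'}" "a' \<le> b'" using ivl[of y l] xk(2) qD by blast
        ultimately show "k = l" using eq by simp
      qed
      \<comment> \<open>Disjoint interiors let sums over tagged pairs become sums over intervals;
        \<open>F a a = 0\<close> takes care of the degenerate ones, whose interior is empty.\<close>
      have sumE: "(\<Sum>(a,b)\<in>E. F a b) = (\<Sum>(x,k)\<in>q. F (Inf k) (Sup k))"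
        if "\<And>a. F a a = 0" for F :: "real \<Rightarrow> real \<Rightarrow> real"
      proof -
        \<comment> \<open>The library lemma also tests \<open>\<delta>\<close> on \<open>{}\<close>, where \<open>Inf\<close> and \<open>Sup\<close> are junk values.\<close>
        define \<delta> where "\<delta> k = (if k = {} then 0 else F (Inf k) (Sup k))" for k
        have \<delta>: "\<delta> k = F (Inf k) (Sup k)" if "(x,k) \<in> q" for x k
          using ivl[of x k] that qD by (force simp: \<delta>_def)
        have "(\<Sum>(x,k)\<in>q. \<delta> k) = (\<Sum>k\<in>snd ` q. \<delta> k)"
        proof (rule sum.over_tagged_division_lemma[OF q])
          fix u v :: real assume "box u v = {}"
          then show "\<delta> (cbox u v) = 0"
            using that by (cases "u = v") (auto simp: \<delta>_def)
        qed
        moreover have "(\<Sum>(x,k)\<in>q. \<delta> k) = (\<Sum>(x,k)\<in>q. F (Inf k) (Sup k))"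
          by (rule sum.cong) (auto simp: \<delta>)
        moreover have "(\<Sum>k\<in>snd ` q. \<delta> k) = (\<Sum>k\<in>snd ` q. F (Inf k) (Sup k))"
          by (rule sum.cong) (auto simp: \<delta>)
        ultimately have "(\<Sum>(x,k)\<in>q. F (Inf k) (Sup k)) = (\<Sum>k\<in>snd ` q. F (Inf k) (Sup k))"
          by simp
        then show ?thesis
          unfolding E_def by (subst sum.reindex[OF inj]) simp
      qed
      have "(\<Sum>(a,b)\<in>E. b - a) = (\<Sum>(x,k)\<in>q. Sup k - Inf k)"
        by (rule sumE) simp
      also have "\<dots> = (\<Sum>(x,k)\<in>q. measure lborel k)"
      proof (rule sum.cong[OF refl], clarsimp)
        fix x k assume "(x,k) \<in> q"
        then obtain a b where "k = {a..b}" "a \<le> b" using ivl[of x k] qD by blast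
        then show "Sup k - Inf k = measure lborel k" by simp
      qed
      also have "\<dots> = (\<Sum>k\<in>snd ` q. measure lborel k)"
        by (rule sum.over_tagged_division_lemma[OF q]) (simp add: content_eq_0_interior interior_cbox)
      also have "\<dots> = (\<Sum>k\<in>snd ` q. measure lebesgue k)"
      proof (rule sum.cong[OF refl], clarsimp)
        fix x k assume "(x,k) \<in> q"
        then obtain a b where "k = {a..b}" "a \<le> b" using ivl[of x k] qD by blast
        then show "measure lborel k = measure lebesgue k" by simp
      qed
      \<comment> \<open>The intervals meet at most in boundary points, so their lengths sum to the
        measure of the union. Fineness puts each interval tagged in \<open>N0\<close> inside
        \<open>U\<close>.\<close>
      also have "\<dots> = measure lebesgue (\<Union>(snd ` q))"
        using content_division[OF qdiv] by simp
      also have "\<dots> \<le> measure lebesgue U"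
      proof (rule measure_mono_fmeasurable[OF _ _ U(3)])
        show "\<Union>(snd ` q) \<subseteq> U"
        proof clarsimp
          fix y x k assume "(x,k) \<in> q" "y \<in> k"
          then show "y \<in> U" using fineD[OF fine, of x k] by (auto simp: q_def \<gamma>_def)
        qed
        show "\<Union>(snd ` q) \<in> sets lebesgue"
          using lmeasurable_division[OF qdiv] by blast
      qed
      finally have lenE: "(\<Sum>(a,b)\<in>E. b - a) < d" using U(4) by simp
      have "(\<Sum>(a,b)\<in>E. \<bar>f b - f a\<bar>) < e / 2"
      proof (rule acd[rule_format], intro conjI lenE)
        show "finite E" using finq by (simp add: E_def)
        show "\<forall>(a, b)\<in>E. 0 \<le> a \<and> a \<le> b \<and> b \<le> T"
        proof (clarsimp simp: E_def)
          fix x k assume "(x,k) \<in> q"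
          then obtain a b where "k = {a..b}" "a \<le> b" "0 \<le> a" "b \<le> T" using ivl[of x k] qD by blast
          then show "0 \<le> Inf k \<and> Inf k \<le> Sup k \<and> Sup k \<le> T" by simp
        qed
        show "disjoint_family_on (\<lambda>(a, b). {a<..<b}) E"
          unfolding disjoint_family_on_def
        proof (intro ballI impI)
          fix m n assume mn: "m \<in> E" "n \<in> E" "m \<noteq> n"
          obtain x k where k: "(x,k) \<in> q" "m = (Inf k, Sup k)" using mn(1) by (auto simp: E_def)
          obtain y l where l: "(y,l) \<in> q" "n = (Inf l, Sup l)" using mn(2) by (auto simp: E_def)
          have "k \<noteq> l" using k l mn(3) by auto
          then have "interior k \<inter> interior l = {}"
            using division_ofD(5)[OF qdiv, of k l] k l by force
          moreover obtain a b where "k = {a..b}" "a \<le> b" using ivl[of x k] k qD by blast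
          moreover obtain a' b' where "l = {a'..b'}" "a' \<le> b'" using ivl[of y l] l qD by blast
          ultimately show "(case m of (a, b) \<Rightarrow> {a<..<b}) \<inter> (case n of (a, b) \<Rightarrow> {a<..<b}) = {}"
            using k l by simp
        qed
      qed
      moreover have "(\<Sum>(a,b)\<in>E. \<bar>f b - f a\<bar>) = (\<Sum>(x,k)\<in>q. \<bar>f (Sup k) - f (Inf k)\<bar>)"
        by (rule sumE) simp
      moreover have "\<bar>\<Sum>(x,k)\<in>q. measure lborel k * h x - (f (Sup k) - f (Inf k))\<bar>
          \<le> (\<Sum>(x,k)\<in>q. \<bar>f (Sup k) - f (Inf k)\<bar>)"
        by (rule sum_abs[THEN order_trans], rule sum_mono) (auto simp: q_def h_def abs_minus_commute)
      ultimately show "norm ((\<Sum>(x,k)\<in>D. measure lborel k *\<^sub>R h x) - (f T - f 0)) < e"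
        using 1 unfolding split real_norm_def by linarith
    qed
  qed
  then have "(h has_integral f T - f 0) {0..T}" by simp
  then show ?thesis
    by (rule has_integral_spike[OF negN, rotated]) (auto simp: h_def)
qed

text \<open>Truncation argument: \<open>min \<bar>g\<bar> k\<close> contributes at most
  \<open>k\<close> times the total length, and the excess over it has small integral for large
  \<open>k\<close> by dominated convergence, regardless of the chosen intervals.\<close>

lemma absolutely_continuous_fn_integral:
  assumes g: "integrable (lebesgue_on {0..T}) g"
  shows "absolutely_continuous_fn T (\<lambda>t. integral {0..t} g)"
  unfolding absolutely_continuous_fn_def
proof (intro allI impI)
  let ?M = "lebesgue_on {0..T}"
  fix e :: real assume e: "e > 0"
  have gm[measurable]: "g \<in> borel_measurable ?M" using g by simp
  have "(\<lambda>k. LINT s|?M. \<bar>g s\<bar> - min \<bar>g s\<bar> (real k)) \<longlonglongrightarrow> (LINT s|?M. 0)"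
  proof (rule integral_dominated_convergence[where w = "\<lambda>s. \<bar>g s\<bar>"])
    show "AE s in ?M. (\<lambda>k. \<bar>g s\<bar> - min \<bar>g s\<bar> (real k)) \<longlonglongrightarrow> 0"
    proof (rule AE_I2, rule tendsto_eventually)
      fix s
      show "\<forall>\<^sub>F k in sequentially. \<bar>g s\<bar> - min \<bar>g s\<bar> (real k) = 0"
        using eventually_ge_at_top[of "nat \<lceil>\<bar>g s\<bar>\<rceil>"]
        by eventually_elim (simp add: min_def nat_ceiling_le_eq)
    qed
  qed (use g in auto)
  then have "\<forall>\<^sub>F k in sequentially. (LINT s|?M. \<bar>g s\<bar> - min \<bar>g s\<bar> (real k)) < e / 2"
    using e by (intro order_tendstoD) auto
  then obtain k :: nat where k: "(LINT s|?M. \<bar>g s\<bar> - min \<bar>g s\<bar> (real k)) < e / 2"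
    by (auto simp: eventually_sequentially)
  \<comment> \<open>Chosen so that the truncated part stays below \<open>e / 2\<close>; the
    \<open>+ 1\<close> covers \<open>k = 0\<close>.\<close>
  define d where "d = e / (2 * (real k + 1))"
  have d: "d > 0" "real k * d < e / 2"
    using e by (auto simp: d_def field_simps)
  have abs_int: "g absolutely_integrable_on {0..T}"
    using g by (simp add: set_integrable_def integrable_restrict_space)
  show "\<exists>d>0. \<forall>D :: (real \<times> real) set.
     finite D \<and> (\<forall>(a, b) \<in> D. 0 \<le> a \<and> a \<le> b \<and> b \<le> T) \<and>
     disjoint_family_on (\<lambda>(a, b). {a<..<b}) D \<and> (\<Sum>(a, b) \<in> D. b - a) < d \<longrightarrow>
     (\<Sum>(a, b) \<in> D. \<bar>integral {0..b} g - integral {0..a} g\<bar>) < e"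
  proof (intro exI[of _ d] conjI allI impI d(1))
    fix D :: "(real \<times> real) set"
    assume "finite D \<and> (\<forall>(a, b) \<in> D. 0 \<le> a \<and> a \<le> b \<and> b \<le> T) \<and>
     disjoint_family_on (\<lambda>(a, b). {a<..<b}) D \<and> (\<Sum>(a, b) \<in> D. b - a) < d"
    then have fin: "finite D" and D: "\<And>a b. (a,b) \<in> D \<Longrightarrow> 0 \<le> a \<and> a \<le> b \<and> b \<le> T"
      and disj: "disjoint_family_on (\<lambda>(a, b). {a<..<b}) D" and len: "(\<Sum>(a, b) \<in> D. b - a) < d"
      by auto
    \<comment> \<open>Open intervals match the disjointness in the definition of absolute
      continuity, which gives the bound 1 on the sum of the indicators. The endpoints are negligible
      for each integral.\<close>
    define \<phi> :: "real \<times> real \<Rightarrow> real \<Rightarrow> real" where "\<phi> p = indicator {fst p<..<snd p}" for p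
    have \<phi>m[measurable]: "\<phi> p \<in> borel_measurable ?M" for p
      unfolding \<phi>_def by (intro measurable_restrict_space1 borel_measurable_indicator) auto
    have \<phi>01: "0 \<le> \<phi> p s" "\<phi> p s \<le> 1" for p s by (auto simp: \<phi>_def indicator_def)
    have \<phi>sum: "(\<Sum>p\<in>D. \<phi> p s) \<le> 1" for s
    proof -
      have "(\<Sum>p\<in>D. \<phi> p s) = (\<Sum>p\<in>D. indicator ((\<lambda>(a, b). {a<..<b}) p) s)"
        by (rule sum.cong) (auto simp: \<phi>_def split_def)
      also have "\<dots> = indicator (\<Union>p\<in>D. (\<lambda>(a, b). {a<..<b}) p) s"
        by (rule indicator_UN_disjoint[OF fin disj, symmetric])
      finally show ?thesis by (simp add: indicator_def)
    qed
    have \<phi>h: "integrable ?M (\<lambda>s. \<phi> p s * \<bar>g s\<bar>)" for p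
    proof (rule Bochner_Integration.integrable_bound[OF g])
      show "(\<lambda>s. \<phi> p s * \<bar>g s\<bar>) \<in> borel_measurable ?M" by measurable
    qed (auto simp: \<phi>_def indicator_def)
    have \<phi>i: "integrable ?M (\<phi> p)" for p
      by (rule finite_measure.integrable_const_bound[OF finite_measure_lebesgue_on, of _ _ 1])
         (use \<phi>m[of p] in \<open>simp_all add: \<phi>01\<close>)
    have \<phi>len: "(LINT s|?M. \<phi> (a,b) s) = b - a" if "(a,b) \<in> D" for a b
    proof -
      have "{a<..<b} \<inter> {0..T} = {a<..<b}" using D[OF that] by auto
      then have "(LINT s|?M. \<phi> (a,b) s) = measure ?M {a<..<b}"
        by (simp add: \<phi>_def)
      also have "\<dots> = measure lebesgue {a<..<b}"
        using D[OF that] by (intro measure_restrict_space) auto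
      finally show ?thesis using D[OF that] by simp
    qed
    have "\<bar>integral {0..b} g - integral {0..a} g\<bar> \<le> (LINT s|?M. \<phi> (a,b) s * \<bar>g s\<bar>)" if ab: "(a,b) \<in> D" for a b
    proof -
      have sub: "{a..b} \<subseteq> {0..T}" "{0..b} \<subseteq> {0..T}" using D[OF ab] by auto
      have int: "g absolutely_integrable_on {a..b}" "g absolutely_integrable_on {0..b}"
        using absolutely_integrable_on_subinterval[OF abs_int] sub by auto
      have "integral {0..b} g - integral {0..a} g = integral {a..b} g"
        using Henstock_Kurzweil_Integration.integral_combine[of 0 a b g] D[OF ab] int(2)
        by (auto simp: absolutely_integrable_on_def)
      also have "\<bar>\<dots>\<bar> \<le> integral {a..b} (\<lambda>s. \<bar>g s\<bar>)"
        using int(1) by (intro integral_norm_bound_integral[where f=g and g="\<lambda>s. \<bar>g s\<bar>", unfolded real_norm_def]) (auto simp: absolutely_integrable_on_def)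
      also have "\<dots> = integral {0..T} (\<lambda>s. if s \<in> {a..b} then \<bar>g s\<bar> else 0)"
        by (simp only: integral_restrict_Int Int_absorb2[OF sub(1)])
      also have "\<dots> = integral {0..T} (\<lambda>s. \<phi> (a,b) s * \<bar>g s\<bar>)"
        by (rule integral_spike[of "{a,b}"]) (auto simp: \<phi>_def indicator_def)
      also have "\<dots> = (LINT s|?M. \<phi> (a,b) s * \<bar>g s\<bar>)"
        using \<phi>h by (simp add: lebesgue_integral_eq_integral)
      finally show ?thesis .
    qed
    then have "(\<Sum>(a, b) \<in> D. \<bar>integral {0..b} g - integral {0..a} g\<bar>)
        \<le> (\<Sum>p \<in> D. LINT s|?M. \<phi> p s * \<bar>g s\<bar>)"
      by (intro sum_mono) auto
    also have "\<dots> = (LINT s|?M. (\<Sum>p \<in> D. \<phi> p s) * \<bar>g s\<bar>)"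
      using \<phi>h by (simp add: sum_distrib_right)
    also have "\<dots> \<le> (LINT s|?M. (\<bar>g s\<bar> - min \<bar>g s\<bar> (real k)) + (\<Sum>p \<in> D. real k * \<phi> p s))"
    proof (rule integral_mono)
      show "integrable ?M (\<lambda>s. (\<Sum>p \<in> D. \<phi> p s) * \<bar>g s\<bar>)"
        using \<phi>h by (simp add: sum_distrib_right)
      have "integrable ?M (\<lambda>s. \<bar>g s\<bar> - min \<bar>g s\<bar> (real k))"
        by (rule Bochner_Integration.integrable_bound[OF g]) auto
      then show "integrable ?M (\<lambda>s. (\<bar>g s\<bar> - min \<bar>g s\<bar> (real k)) + (\<Sum>p \<in> D. real k * \<phi> p s))"
        using \<phi>i by auto
      fix s
      \<comment> \<open>The overlap bound \<open>\<phi>sum\<close> absorbs the indicators in front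
        of the excess, while in front of the truncated part they are kept, because their integrals
        are the interval lengths.\<close>
      have "(\<Sum>p \<in> D. \<phi> p s) * \<bar>g s\<bar>
          = (\<Sum>p \<in> D. \<phi> p s) * (\<bar>g s\<bar> - min \<bar>g s\<bar> (real k)) + (\<Sum>p \<in> D. \<phi> p s) * min \<bar>g s\<bar> (real k)"
        by (simp add: algebra_simps)
      also have "\<dots> \<le> 1 * (\<bar>g s\<bar> - min \<bar>g s\<bar> (real k)) + (\<Sum>p \<in> D. \<phi> p s) * real k"
        using \<phi>sum[of s] \<phi>01 by (intro add_mono mult_mono sum_nonneg) auto
      finally show "(\<Sum>p \<in> D. \<phi> p s) * \<bar>g s\<bar> \<le> (\<bar>g s\<bar> - min \<bar>g s\<bar> (real k)) + (\<Sum>p \<in> D. real k * \<phi> p s)"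
        by (simp add: sum_distrib_left mult.commute)
    qed
    also have "\<dots> = (LINT s|?M. \<bar>g s\<bar> - min \<bar>g s\<bar> (real k)) + (\<Sum>p \<in> D. real k * (LINT s|?M. \<phi> p s))"
    proof -
      have "integrable ?M (\<lambda>s. \<bar>g s\<bar> - min \<bar>g s\<bar> (real k))"
        by (rule Bochner_Integration.integrable_bound[OF g]) auto
      then show ?thesis using \<phi>i by (simp add: Bochner_Integration.integral_add Bochner_Integration.integral_sum)
    qed
    also have "(\<Sum>p \<in> D. real k * (LINT s|?M. \<phi> p s)) = real k * (\<Sum>(a,b) \<in> D. b - a)"
      unfolding sum_distrib_left by (rule sum.cong) (auto simp: \<phi>len)
    also have "\<dots> \<le> real k * d" using len by (intro mult_left_mono) auto
    finally show "(\<Sum>(a, b) \<in> D. \<bar>integral {0..b} g - integral {0..a} g\<bar>) < e"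
      using k d(2) by linarith
  qed
qed

text \<open>Lebesgue differentiation is applied twice, to right-hand difference quotients: once to
  the function itself and once to its reflection \<open>t \<mapsto> f (- t)\<close>, whose
  right-hand quotients at \<open>- t\<close> are the left-hand quotients of the original at
  \<open>t\<close>.\<close>

lemma AE_has_real_derivative_integral:
  fixes g :: "real \<Rightarrow> real"
  assumes g: "integrable (lebesgue_on {0..T}) g"
  shows "AE t in lebesgue_on {0..T}.
    ((\<lambda>t. integral {0..t} g) has_real_derivative g t) (at t within {0..T})"
proof -
  have gi: "g integrable_on {0..T}"
    by (rule integrable_on_lebesgue_on[OF g]) simp
  \<comment> \<open>Extension by zero gives integrability on every box, as the differentiation
    theorem requires; near \<open>t\<close> only values inside \<open>{0..T}\<close> are compared
    afterwards.\<close>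
  define f where "f t = (if t \<in> {0..T} then g t else 0)" for t
  have fU: "f integrable_on UNIV"
    using gi unfolding f_def by (simp only: integrable_restrict_UNIV)
  then have f: "f integrable_on cbox a b" for a b
    using integrable_on_subcbox by blast
  have fr: "(\<lambda>t. f (- t)) integrable_on cbox a b" for a b
    using f[of "-b" "-a"] Henstock_Kurzweil_Integration.integrable_reflect_real[where f = f and a = "- b" and b = "- a"] by simp
  obtain N where N: "negligible N" "\<And>x e. x \<notin> N \<Longrightarrow> 0 < e \<Longrightarrow>
      \<exists>d>0. \<forall>h. 0 < h \<and> h < d \<longrightarrow> \<bar>integral {x..x + h} f / h - f x\<bar> < e"
    using integrable_ccontinuous_explicit[OF f] by (auto simp: divide_inverse mult.commute)
  obtain N' where N': "negligible N'" "\<And>x e. x \<notin> N' \<Longrightarrow> 0 < e \<Longrightarrow>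
      \<exists>d>0. \<forall>h. 0 < h \<and> h < d \<longrightarrow> \<bar>integral {x..x + h} (\<lambda>t. f (- t)) / h - f (- x)\<bar> < e"
    using integrable_ccontinuous_explicit[OF fr] by (auto simp: divide_inverse mult.commute)
  have "negligible (uminus ` N')"
    by (rule negligible_differentiable_image_negligible[OF _ N'(1)]) (auto intro!: derivative_intros)
  with N(1) have "negligible (N \<union> uminus ` N')" by (rule negligible_Un)
  then have "N \<union> uminus ` N' \<in> null_sets lebesgue" by (simp add: negligible_iff_null_sets)
  moreover have "((\<lambda>t. integral {0..t} g) has_real_derivative g t) (at t within {0..T})"
    if t: "t \<in> {0..T}" "t \<notin> N \<union> uminus ` N'" for t
    unfolding has_field_derivative_def has_derivative_within_alt
  proof (intro conjI allI impI)
    show "bounded_linear ((*) (g t))" by (rule bounded_linear_mult_right)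
    fix e :: real assume e: "e > 0"
    have tN: "t \<notin> N" "- t \<notin> N'" using t(2) by (auto simp: image_iff)
    obtain d1 where d1: "d1 > 0" "\<And>h. 0 < h \<Longrightarrow> h < d1 \<Longrightarrow> \<bar>integral {t..t + h} f / h - f t\<bar> < e"
      using N(2)[OF tN(1) e] by blast
    obtain d2 where d2: "d2 > 0"
      "\<And>h. 0 < h \<Longrightarrow> h < d2 \<Longrightarrow> \<bar>integral {- t..- t + h} (\<lambda>t. f (- t)) / h - f t\<bar> < e"
      using N'(2)[OF tN(2) e] by auto
    have diff: "integral {0..b} g - integral {0..a} g = integral {a..b} f"
      if "0 \<le> a" "a \<le> b" "b \<le> T" for a b
    proof -
      have "g integrable_on {0..b}"
        using integrable_on_subinterval[OF gi] that by auto
      then have "integral {0..b} g - integral {0..a} g = integral {a..b} g"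
        using Henstock_Kurzweil_Integration.integral_combine[of 0 a b g] that by auto
      also have "\<dots> = integral {a..b} f"
        using that by (intro Henstock_Kurzweil_Integration.integral_cong) (auto simp: f_def)
      finally show ?thesis .
    qed
    have "norm (integral {0..y} g - integral {0..t} g - g t * (y - t)) \<le> e * norm (y - t)"
      if y: "y \<in> {0..T}" "norm (y - t) < min d1 d2" for y
    proof -
      consider "y = t" | "y > t" | "y < t" by linarith
      then show ?thesis
      proof cases
        case 2
        have "\<bar>integral {t..y} f / (y - t) - g t\<bar> < e"
          using d1(2)[of "y - t"] 2 y t by (auto simp: f_def)
        then have "\<bar>integral {t..y} f - g t * (y - t)\<bar> \<le> e * (y - t)"
          using 2 by (simp add: abs_less_iff abs_le_iff field_simps)
        then show ?thesis using diff[of t y] 2 y t by simp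
      next
        case 3
        have "integral {- t..- y} (\<lambda>t. f (- t)) = integral {y..t} f"
          using integral_reflect_real[of t y f] by simp
        then have "\<bar>integral {y..t} f / (t - y) - g t\<bar> < e"
          using d2(2)[of "t - y"] 3 y t by (auto simp: f_def)
        then have "\<bar>integral {y..t} f - g t * (t - y)\<bar> \<le> e * (t - y)"
          using 3 by (simp add: abs_less_iff abs_le_iff field_simps)
        then show ?thesis using diff[of y t] 3 y t by (simp add: abs_le_iff algebra_simps)
      qed simp
    qed
    then show "\<exists>d>0. \<forall>y\<in>{0..T}. norm (y - t) < d \<longrightarrow>
        norm (integral {0..y} g - integral {0..t} g - g t * (y - t)) \<le> e * norm (y - t)"
      using d1(1) d2(1) by (intro exI[of _ "min d1 d2"]) auto
  qed
  ultimately show ?thesis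
    by (subst AE_restrict_space_iff) (auto intro!: AE_I'[of "N \<union> uminus ` N'"])
qed

section \<open>Linear combinations of absolutely continuous functions\<close>

lemma absolutely_continuous_fn_add:
  assumes f: "absolutely_continuous_fn T f" and g: "absolutely_continuous_fn T g"
  shows "absolutely_continuous_fn T (\<lambda>t. f t + g t)"
  unfolding absolutely_continuous_fn_def
proof (intro allI impI)
  fix e :: real assume "e > 0"
  then have e: "e / 2 > 0" by simp
  obtain d1 where d1: "d1 > 0" "\<forall>D. finite D \<and> (\<forall>(a, b) \<in> D. 0 \<le> a \<and> a \<le> b \<and> b \<le> T) \<and>
     disjoint_family_on (\<lambda>(a, b). {a<..<b}) D \<and> (\<Sum>(a, b) \<in> D. b - a) < d1 \<longrightarrow>
     (\<Sum>(a, b) \<in> D. \<bar>f b - f a\<bar>) < e / 2"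
    using f[unfolded absolutely_continuous_fn_def, rule_format, OF e] by blast
  obtain d2 where d2: "d2 > 0" "\<forall>D. finite D \<and> (\<forall>(a, b) \<in> D. 0 \<le> a \<and> a \<le> b \<and> b \<le> T) \<and>
     disjoint_family_on (\<lambda>(a, b). {a<..<b}) D \<and> (\<Sum>(a, b) \<in> D. b - a) < d2 \<longrightarrow>
     (\<Sum>(a, b) \<in> D. \<bar>g b - g a\<bar>) < e / 2"
    using g[unfolded absolutely_continuous_fn_def, rule_format, OF e] by blast
  show "\<exists>d>0. \<forall>D. finite D \<and> (\<forall>(a, b) \<in> D. 0 \<le> a \<and> a \<le> b \<and> b \<le> T) \<and>
     disjoint_family_on (\<lambda>(a, b). {a<..<b}) D \<and> (\<Sum>(a, b) \<in> D. b - a) < d \<longrightarrow>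
     (\<Sum>(a, b) \<in> D. \<bar>(f b + g b) - (f a + g a)\<bar>) < e"
  proof (intro exI[of _ "min d1 d2"] conjI allI impI)
    fix D :: "(real \<times> real) set"
    assume D: "finite D \<and> (\<forall>(a, b) \<in> D. 0 \<le> a \<and> a \<le> b \<and> b \<le> T) \<and>
     disjoint_family_on (\<lambda>(a, b). {a<..<b}) D \<and> (\<Sum>(a, b) \<in> D. b - a) < min d1 d2"
    have "(\<Sum>(a, b) \<in> D. \<bar>(f b + g b) - (f a + g a)\<bar>)
        \<le> (\<Sum>(a, b) \<in> D. \<bar>f b - f a\<bar>) + (\<Sum>(a, b) \<in> D. \<bar>g b - g a\<bar>)"
      unfolding sum.distrib[symmetric] by (rule sum_mono) auto
    also have "\<dots> < e / 2 + e / 2"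
      using d1(2) d2(2) D by (intro add_strict_mono) auto
    finally show "(\<Sum>(a, b) \<in> D. \<bar>(f b + g b) - (f a + g a)\<bar>) < e" by simp
  qed (use d1 d2 in simp)
qed

lemma absolutely_continuous_fn_cmult:
  assumes f: "absolutely_continuous_fn T f"
  shows "absolutely_continuous_fn T (\<lambda>t. r * f t)"
  unfolding absolutely_continuous_fn_def
proof (intro allI impI)
  fix e :: real assume "e > 0"
  \<comment> \<open>The \<open>+ 1\<close> in the denominator covers \<open>r = 0\<close>.\<close>
  then have e: "e / (\<bar>r\<bar> + 1) > 0" by simp
  obtain d where d: "d > 0" "\<forall>D. finite D \<and> (\<forall>(a, b) \<in> D. 0 \<le> a \<and> a \<le> b \<and> b \<le> T) \<and>
     disjoint_family_on (\<lambda>(a, b). {a<..<b}) D \<and> (\<Sum>(a, b) \<in> D. b - a) < d \<longrightarrow>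
     (\<Sum>(a, b) \<in> D. \<bar>f b - f a\<bar>) < e / (\<bar>r\<bar> + 1)"
    using f[unfolded absolutely_continuous_fn_def, rule_format, OF e] by blast
  show "\<exists>d>0. \<forall>D. finite D \<and> (\<forall>(a, b) \<in> D. 0 \<le> a \<and> a \<le> b \<and> b \<le> T) \<and>
     disjoint_family_on (\<lambda>(a, b). {a<..<b}) D \<and> (\<Sum>(a, b) \<in> D. b - a) < d \<longrightarrow>
     (\<Sum>(a, b) \<in> D. \<bar>r * f b - r * f a\<bar>) < e"
  proof (intro exI[of _ d] conjI allI impI d(1))
    fix D :: "(real \<times> real) set"
    assume D: "finite D \<and> (\<forall>(a, b) \<in> D. 0 \<le> a \<and> a \<le> b \<and> b \<le> T) \<and>
     disjoint_family_on (\<lambda>(a, b). {a<..<b}) D \<and> (\<Sum>(a, b) \<in> D. b - a) < d"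
    have "(\<Sum>(a, b) \<in> D. \<bar>r * f b - r * f a\<bar>) = \<bar>r\<bar> * (\<Sum>(a, b) \<in> D. \<bar>f b - f a\<bar>)"
      unfolding sum_distrib_left
      by (rule sum.cong) (auto simp: right_diff_distrib[symmetric] abs_mult)
    also have "\<dots> \<le> (\<bar>r\<bar> + 1) * (\<Sum>(a, b) \<in> D. \<bar>f b - f a\<bar>)"
      by (intro mult_right_mono sum_nonneg) auto
    also have "\<dots> < e"
      using d(2) D by (simp add: pos_less_divide_eq add_nonneg_pos mult.commute)
    finally show "(\<Sum>(a, b) \<in> D. \<bar>r * f b - r * f a\<bar>) < e" .
  qed
qed

lemma absolutely_continuous_fn_const: "absolutely_continuous_fn T (\<lambda>t. r)"
  by (auto simp: absolutely_continuous_fn_def split_def intro!: exI[of _ 1])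

lemma absolutely_continuous_fn_sum:
  assumes "finite A" "\<And>k. k \<in> A \<Longrightarrow> absolutely_continuous_fn T (f k)"
  shows "absolutely_continuous_fn T (\<lambda>t. \<Sum>k\<in>A. f k t)"
  using assms
  by (induction A) (auto intro: absolutely_continuous_fn_const absolutely_continuous_fn_add)

section \<open>Reachability with an invertible mass matrix\<close>

text \<open>Writes a matrix-vector product as an explicit finite sum, to which the linearity rules
  for integrals and derivatives and the closure of absolute continuity under sums apply.\<close>

lemma mult_mat_vec_index_sum:
  assumes "A \<in> carrier_mat n m" "v \<in> carrier_vec m" "i < n"
  shows "vec_index (A *\<^sub>v v) i = (\<Sum>k<m. A $$ (i, k) * vec_index v k)"
  using assms by (auto simp: scalar_prod_def atLeast0LessThan intro!: sum.cong)

section \<open>Componentwise time integrals of vector-valued data\<close>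

lemma L1_time_integrable:
  "L1_time T n f \<Longrightarrow> i < n \<Longrightarrow> integrable (lebesgue_on {0..T}) (\<lambda>t. vec_index (f t) i)"
  and L1_time_carrier: "L1_time T n f \<Longrightarrow> f t \<in> carrier_vec n"
  and L1_time_dim: "L1_time T n f \<Longrightarrow> dim_vec (f t) = n"
  unfolding L1_time_def by (blast, blast, metis carrier_vecD)

lemma L1_time_add:
  assumes f: "L1_time T n f" and g: "L1_time T n g"
  shows "L1_time T n (\<lambda>t. f t + g t)"
  unfolding L1_time_def
  by (simp add: L1_time_carrier[OF f] L1_time_carrier[OF g] L1_time_dim[OF f] L1_time_dim[OF g]
      L1_time_integrable[OF f] L1_time_integrable[OF g])

lemma L1_time_minus:
  assumes f: "L1_time T n f" and g: "L1_time T n g"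
  shows "L1_time T n (\<lambda>t. f t - g t)"
  unfolding L1_time_def
  by (simp add: L1_time_carrier[OF f] L1_time_carrier[OF g] L1_time_dim[OF f] L1_time_dim[OF g]
      L1_time_integrable[OF f] L1_time_integrable[OF g])

lemma L1_time_uminus:
  assumes f: "L1_time T n f"
  shows "L1_time T n (\<lambda>t. - f t)"
  unfolding L1_time_def
  by (simp add: L1_time_carrier[OF f] L1_time_dim[OF f] L1_time_integrable[OF f])

lemma L1_time_mult_mat_vec:
  assumes A: "A \<in> carrier_mat n m" and f: "L1_time T m f"
  shows "L1_time T n (\<lambda>t. A *\<^sub>v f t)"
  unfolding L1_time_def
proof (intro conjI allI impI)
  show "A *\<^sub>v f t \<in> carrier_vec n" for t
    using A L1_time_carrier[OF f] by (rule mult_mat_vec_carrier)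
  fix i assume i: "i < n"
  have "(\<lambda>t. vec_index (A *\<^sub>v f t) i) = (\<lambda>t. \<Sum>k<m. A $$ (i, k) * vec_index (f t) k)"
    using mult_mat_vec_index_sum[OF A L1_time_carrier[OF f] i] by simp
  then show "integrable (lebesgue_on {0..T}) (\<lambda>t. vec_index (A *\<^sub>v f t) i)"
    using L1_time_integrable[OF f]
    by (auto intro!: Bochner_Integration.integrable_sum Bochner_Integration.integrable_mult_right)
qed

lemma time_integral_carrier [simp]: "time_integral T n f \<in> carrier_vec n"
  by (simp add: time_integral_def)

lemma time_integral_add:
  assumes f: "L1_time T n f" and g: "L1_time T n g"
  shows "time_integral T n (\<lambda>t. f t + g t) = time_integral T n f + time_integral T n g"
  by (intro eq_vecI) (simp_all add: time_integral_def L1_time_dim[OF f] L1_time_dim[OF g]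
      L1_time_integrable[OF f] L1_time_integrable[OF g])

lemma time_integral_minus:
  assumes f: "L1_time T n f" and g: "L1_time T n g"
  shows "time_integral T n (\<lambda>t. f t - g t) = time_integral T n f - time_integral T n g"
  by (intro eq_vecI) (simp_all add: time_integral_def L1_time_dim[OF f] L1_time_dim[OF g]
      L1_time_integrable[OF f] L1_time_integrable[OF g])

lemma time_integral_uminus:
  assumes f: "L1_time T n f"
  shows "time_integral T n (\<lambda>t. - f t) = - time_integral T n f"
  by (intro eq_vecI) (simp_all add: time_integral_def L1_time_dim[OF f])

lemma time_integral_mult_mat_vec:
  assumes A: "A \<in> carrier_mat n m" and f: "L1_time T m f"
  shows "time_integral T n (\<lambda>t. A *\<^sub>v f t) = A *\<^sub>v time_integral T m f"
proof (rule eq_vecI)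
  fix i assume "i < dim_vec (A *\<^sub>v time_integral T m f)"
  then have i: "i < n" using A by simp
  have "vec_index (time_integral T n (\<lambda>t. A *\<^sub>v f t)) i
      = (LINT t|lebesgue_on {0..T}. (\<Sum>k<m. A $$ (i, k) * vec_index (f t) k))"
    using i mult_mat_vec_index_sum[OF A _ i] L1_time_carrier[OF f] by (simp add: time_integral_def)
  also have "\<dots> = (\<Sum>k<m. A $$ (i, k) * (LINT t|lebesgue_on {0..T}. vec_index (f t) k))"
    using L1_time_integrable[OF f] by (subst Bochner_Integration.integral_sum) auto
  also have "\<dots> = vec_index (A *\<^sub>v time_integral T m f) i"
    using mult_mat_vec_index_sum[OF A _ i, of "time_integral T m f"] by (simp add: time_integral_def)
  finally show "vec_index (time_integral T n (\<lambda>t. A *\<^sub>v f t)) i = vec_index (A *\<^sub>v time_integral T m f) i" .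
qed (use A in \<open>simp add: time_integral_def\<close>)

lemma L2_time_imp_L1_time: "L2_time T n f \<Longrightarrow> L1_time T n f"
  by (auto simp: L2_time_def L1_time_def intro!: L2_imp_integrable)

text \<open>The fundamental theorem is applied to each row of \<open>M *\<^sub>v c t\<close>, not to
  the components of \<open>c\<close>: the derivative of the row is a component of \<open>F\<close>,
  which is known to be integrable.\<close>

lemma solves_imp_mass_balance:
  assumes T: "0 \<le> T" and M: "M \<in> carrier_mat b b" and F: "L1_time T b F" and c: "solves T b M F c"
  shows "M *\<^sub>v (c T - c 0) = time_integral T b F"
proof (rule eq_vecI)
  fix i assume "i < dim_vec (time_integral T b F)"
  then have i: "i < b" by (simp add: time_integral_def)
  have cc: "c t \<in> carrier_vec b" if "t \<in> {0..T}" for t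
    using c that by (simp add: solves_def)
  define h where "h t = (\<Sum>k<b. M $$ (i, k) * vec_index (c t) k)" for t
  have ac: "absolutely_continuous_fn T h"
    unfolding h_def using c
    by (intro absolutely_continuous_fn_sum absolutely_continuous_fn_cmult) (auto simp: solves_def)
  have "AE t in lebesgue_on {0..T}. \<exists>c' \<in> carrier_vec b.
        (\<forall>i < b. ((\<lambda>s. vec_index (c s) i) has_real_derivative vec_index c' i) (at t within {0..T})) \<and>
        M *\<^sub>v c' = F t"
    using c by (simp add: solves_def)
  then have "AE t in lebesgue_on {0..T}. (h has_real_derivative vec_index (F t) i) (at t within {0..T})"
  proof (rule AE_mp, intro AE_I2 impI)
    fix t
    assume "\<exists>c' \<in> carrier_vec b.
        (\<forall>i < b. ((\<lambda>s. vec_index (c s) i) has_real_derivative vec_index c' i) (at t within {0..T})) \<and>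
        M *\<^sub>v c' = F t"
    then obtain c' where c': "c' \<in> carrier_vec b" "M *\<^sub>v c' = F t"
      "\<And>i. i < b \<Longrightarrow> ((\<lambda>s. vec_index (c s) i) has_real_derivative vec_index c' i) (at t within {0..T})"
      by auto
    have "(h has_real_derivative (\<Sum>k<b. M $$ (i, k) * vec_index c' k)) (at t within {0..T})"
      unfolding h_def using c'(3) by (intro DERIV_sum DERIV_cmult) auto
    then show "(h has_real_derivative vec_index (F t) i) (at t within {0..T})"
      using mult_mat_vec_index_sum[OF M c'(1) i] c'(2) by simp
  qed
  then have "((\<lambda>t. vec_index (F t) i) has_integral h T - h 0) {0..T}"
    by (rule absolutely_continuous_fn_has_integral[OF T ac])
  then have "(LINT t|lebesgue_on {0..T}. vec_index (F t) i) = h T - h 0"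
    using L1_time_integrable[OF F i] by (simp add: lebesgue_integral_eq_integral integral_unique)
  also have "\<dots> = vec_index (M *\<^sub>v (c T - c 0)) i"
  proof -
    have "c T - c 0 \<in> carrier_vec b" "dim_vec (c 0) = b"
      using cc[of T] cc[of 0] T by auto
    then show ?thesis
      using mult_mat_vec_index_sum[OF M _ i, of "c T - c 0"]
      by (simp add: h_def sum_subtractf[symmetric] right_diff_distrib)
  qed
  finally show "vec_index (M *\<^sub>v (c T - c 0)) i = vec_index (time_integral T b F) i"
    using i by (simp add: time_integral_def)
qed (use M in \<open>simp add: time_integral_def\<close>)

text \<open>The solution is written down as \<open>c0\<close> plus \<open>N\<close> applied to the
  indefinite integral of \<open>F\<close>; its almost everywhere derivative is
  \<open>N *\<^sub>v F t\<close>, which \<open>M\<close> maps back to \<open>F t\<close>.\<close>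

lemma solves_exists:
  assumes T: "0 \<le> T" and M: "M \<in> carrier_mat b b" and N: "N \<in> carrier_mat b b" "M * N = 1\<^sub>m b"
    and F: "L1_time T b F" and c0: "c0 \<in> carrier_vec b"
  obtains c where "solves T b M F c" "c 0 = c0"
proof -
  define I where "I t = Matrix.vec b (\<lambda>k. integral {0..t} (\<lambda>s. vec_index (F s) k))" for t
  have I: "I t \<in> carrier_vec b" for t by (simp add: I_def)
  let ?c = "\<lambda>t. c0 + N *\<^sub>v I t"
  have ci: "vec_index (?c t) i
      = vec_index c0 i + (\<Sum>k<b. N $$ (i, k) * integral {0..t} (\<lambda>s. vec_index (F s) k))" if "i < b" for t i
    using mult_mat_vec_index_sum[OF N(1) I that, of t] that N(1) by (simp add: I_def)
  have z: "?c 0 = c0"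
  proof (rule eq_vecI)
    fix i assume "i < dim_vec c0"
    then show "vec_index (?c 0) i = vec_index c0 i" using ci[of i 0] c0 by simp
  qed (use c0 N in simp)
  have sol: "solves T b M F ?c"
    unfolding solves_def
  proof (intro conjI ballI allI impI)
    show "?c t \<in> carrier_vec b" for t using c0 N I by simp
    show "absolutely_continuous_fn T (\<lambda>t. vec_index (?c t) i)" if i: "i < b" for i
      unfolding ci[OF i]
      by (intro absolutely_continuous_fn_add absolutely_continuous_fn_const absolutely_continuous_fn_sum
          absolutely_continuous_fn_cmult absolutely_continuous_fn_integral L1_time_integrable[OF F]) auto
    \<comment> \<open>There are finitely many components, so their exceptional null sets combine
      into one.\<close>
    have "AE t in lebesgue_on {0..T}. \<forall>k\<in>{..<b}. ((\<lambda>t. integral {0..t} (\<lambda>s. vec_index (F s) k))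
        has_real_derivative vec_index (F t) k) (at t within {0..T})"
      by (intro AE_finite_allI AE_has_real_derivative_integral L1_time_integrable[OF F]) auto
    then show "AE t in lebesgue_on {0..T}. \<exists>c' \<in> carrier_vec b.
        (\<forall>i < b. ((\<lambda>s. vec_index (?c s) i) has_real_derivative vec_index c' i) (at t within {0..T})) \<and>
        M *\<^sub>v c' = F t"
    proof (rule AE_mp, intro AE_I2 impI)
      fix t
      assume der: "\<forall>k\<in>{..<b}. ((\<lambda>t. integral {0..t} (\<lambda>s. vec_index (F s) k))
        has_real_derivative vec_index (F t) k) (at t within {0..T})"
      show "\<exists>c' \<in> carrier_vec b.
        (\<forall>i < b. ((\<lambda>s. vec_index (?c s) i) has_real_derivative vec_index c' i) (at t within {0..T})) \<and>
        M *\<^sub>v c' = F t"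
      proof (intro bexI[of _ "N *\<^sub>v F t"] conjI allI impI)
        fix i assume i: "i < b"
        have "((\<lambda>s. vec_index c0 i + (\<Sum>k<b. N $$ (i, k) * integral {0..s} (\<lambda>s. vec_index (F s) k)))
            has_real_derivative 0 + (\<Sum>k<b. N $$ (i, k) * vec_index (F t) k)) (at t within {0..T})"
          using der by (intro DERIV_add DERIV_const DERIV_sum DERIV_cmult) auto
        then show "((\<lambda>s. vec_index (?c s) i) has_real_derivative vec_index (N *\<^sub>v F t) i) (at t within {0..T})"
          unfolding ci[OF i] mult_mat_vec_index_sum[OF N(1) L1_time_carrier[OF F] i] by simp
      next
        show "M *\<^sub>v (N *\<^sub>v F t) = F t"
          using assoc_mult_mat_vec[OF M N(1) L1_time_carrier[OF F], of t] N(2) L1_time_carrier[OF F, of t]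
          by simp
      qed (use N L1_time_carrier[OF F] in auto)
    qed
  qed
  show ?thesis by (rule that[OF sol z])
qed

section \<open>Matrix ranges and reachable sets\<close>

lemma injective_mat_inverse:
  fixes M :: "real mat"
  assumes M: "M \<in> carrier_mat b b"
    and inj: "\<And>v. v \<in> carrier_vec b \<Longrightarrow> M *\<^sub>v v = 0\<^sub>v b \<Longrightarrow> v = 0\<^sub>v b"
  obtains N where "N \<in> carrier_mat b b" "M * N = 1\<^sub>m b" "N * M = 1\<^sub>m b"
proof -
  have "Determinant.det M \<noteq> 0"
    using det_0_iff_vec_prod_zero_field[OF M] inj by blast
  then have "M \<in> Units (ring_mat TYPE(real) b ())"
    by (rule det_non_zero_imp_unit[OF M])
  then show ?thesis
    using that unfolding Units_def ring_mat_def by auto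
qed

lemma mat_range_iff: "G \<in> carrier_mat n m \<Longrightarrow> y \<in> mat_range G \<longleftrightarrow> (\<exists>u \<in> carrier_vec m. y = G *\<^sub>v u)"
  by (auto simp: mat_range_def)

lemma set_cols_subset_carrier: "G \<in> carrier_mat n m \<Longrightarrow> set (cols G) \<subseteq> carrier_vec n"
  using cols_dim[of G] by auto

text \<open>Connects the image of the matrix with the column span, the object through which
  \<open>rank\<close> is defined and for which subspace and dimension facts are available.\<close>

lemma mat_range_eq_span:
  assumes "G \<in> carrier_mat n m"
  shows "mat_range G = LinearCombinations.module.span class_ring (module_vec TYPE(real) n) (set (cols G))"
proof -
  interpret vec_space "TYPE(real)" n .
  show ?thesis
    using col_space_eq[OF assms] assms
    by (auto simp: col_space_def mat_range_def)
qed

text \<open>Membership of \<open>cT\<close> in the carrier is part of the equivalence, so that it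
  also describes the whole set of reachable states, where the candidate is an arbitrary
  vector.\<close>

lemma reachable_iff:
  assumes T: "0 < T" and M: "M \<in> carrier_mat b b"
    and N: "N \<in> carrier_mat b b" "M * N = 1\<^sub>m b" "N * M = 1\<^sub>m b"
    and G: "G \<in> carrier_mat b m" and f: "L1_time T b f"
    and c0: "c0 \<in> carrier_vec b"
  shows "reachable T b m M (\<lambda>a t. G *\<^sub>v a t + f t) c0 cT \<longleftrightarrow>
    cT \<in> carrier_vec b \<and> M *\<^sub>v (cT - c0) - time_integral T b f \<in> mat_range G" (is "?L \<longleftrightarrow> ?R")
proof -
  define F where "F a t = G *\<^sub>v a t + f t" for a t
  have int: "L1_time T b (F a)"
    "time_integral T b (F a) = G *\<^sub>v time_integral T m a + time_integral T b f"
    if a: "L2_time T m a" for a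
  proof -
    note a1 = L2_time_imp_L1_time[OF a]
    show "L1_time T b (F a)"
      unfolding F_def by (intro L1_time_add L1_time_mult_mat_vec[OF G a1] f)
    show "time_integral T b (F a) = G *\<^sub>v time_integral T m a + time_integral T b f"
      unfolding F_def
      using time_integral_add[OF L1_time_mult_mat_vec[OF G a1] f] time_integral_mult_mat_vec[OF G a1] by simp
  qed
  show ?thesis
  proof
    assume ?L
    then obtain a c where a: "L2_time T m a" and c: "solves T b M (F a) c" "c 0 = c0" "c T = cT"
      unfolding reachable_def F_def by blast
    have "cT \<in> carrier_vec b" using c T by (auto simp: solves_def)
    moreover have "M *\<^sub>v (cT - c0) = G *\<^sub>v time_integral T m a + time_integral T b f"
      using solves_imp_mass_balance[OF _ M int(1)[OF a] c(1)] T int(2)[OF a] c by simp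
    then have "M *\<^sub>v (cT - c0) - time_integral T b f = G *\<^sub>v time_integral T m a"
      using G by (intro eq_vecI) (auto simp: time_integral_def)
    then have "M *\<^sub>v (cT - c0) - time_integral T b f \<in> mat_range G"
      using mat_range_iff[OF G] by auto
    ultimately show ?R by simp
  next
    assume R: ?R
    then obtain u where u: "u \<in> carrier_vec m" "M *\<^sub>v (cT - c0) - time_integral T b f = G *\<^sub>v u"
      using mat_range_iff[OF G] by auto
    define a :: "real \<Rightarrow> real vec" where "a t = (1 / T) \<cdot>\<^sub>v u" for t
    have a: "L2_time T m a"
      using u finite_measure.integrable_const[OF finite_measure_lebesgue_on[of "{0..T}"]]
      by (auto simp: L2_time_def L2_def a_def)
    have "time_integral T m a = u"
    proof (rule eq_vecI)
      fix i assume "i < dim_vec u"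
      moreover have "measure (lebesgue_on {0..T}) {0..T} = T"
        using T by (subst measure_restrict_space) auto
      ultimately show "vec_index (time_integral T m a) i = vec_index u i"
        using u T by (simp add: time_integral_def a_def)
    qed (use u in \<open>simp add: time_integral_def\<close>)
    then have tot: "time_integral T b (F a) = M *\<^sub>v (cT - c0)"
    proof -
      have "M *\<^sub>v (cT - c0) \<in> carrier_vec b" using M c0 R by auto
      moreover have "time_integral T b (F a) = (M *\<^sub>v (cT - c0) - time_integral T b f) + time_integral T b f"
        using int(2)[OF a] \<open>time_integral T m a = u\<close> u(2) by simp
      moreover have "v - w + w = v" if "v \<in> carrier_vec b" "w \<in> carrier_vec b" for v w :: "real vec"
        using that by (intro eq_vecI) auto
      ultimately show ?thesis by simp
    qed
    obtain c where c: "solves T b M (F a) c" "c 0 = c0"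
      using solves_exists[OF _ M N(1,2) int(1)[OF a] c0] T by auto
    have cc: "c T \<in> carrier_vec b" using c T by (auto simp: solves_def)
    \<comment> \<open>The end point depends on the control only through the time integral of the
      right-hand side, and \<open>N\<close> cancels \<open>M\<close>; so the solution that was found
      ends at \<open>cT\<close>.\<close>
    have "M *\<^sub>v (c T - c0) = M *\<^sub>v (cT - c0)"
      using solves_imp_mass_balance[OF _ M int(1)[OF a] c(1)] T tot c(2) by simp
    then have "N *\<^sub>v (M *\<^sub>v (c T - c0)) = N *\<^sub>v (M *\<^sub>v (cT - c0))" by simp
    then have eq: "c T - c0 = cT - c0"
      using assoc_mult_mat_vec[OF N(1) M, of "c T - c0"] assoc_mult_mat_vec[OF N(1) M, of "cT - c0"]
        N(3) cc c0 R by simp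
    have "c T = (c T - c0) + c0" using cc c0 by auto
    also have "\<dots> = cT" unfolding eq using c0 R by auto
    finally show ?L using a c unfolding reachable_def F_def by blast
  qed
qed

text \<open>\<open>N\<close> has the left inverse \<open>M\<close>, so it restricts to a linear
  isomorphism from the range of \<open>G\<close> onto that of \<open>N * G\<close>. The range of
  \<open>G\<close> is the span of its columns, whose dimension is the rank.\<close>

lemma subspace_dim_image_mat:
  fixes N G :: "real mat"
  assumes M: "M \<in> carrier_mat b b" and N: "N \<in> carrier_mat b b" "M * N = 1\<^sub>m b"
    and G: "G \<in> carrier_mat b m"
  shows "subspace_dim b (mat_range (N * G)) = vec_space.rank b G"
proof -
  interpret vec_space "TYPE(real)" b .
  have NG: "N * G \<in> carrier_mat b m" using N G by simp
  have sub: "VectorSpace.subspace class_ring (mat_range A) V" if "A \<in> carrier_mat b m" for A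
    unfolding mat_range_eq_span[OF that] using set_cols_subset_carrier[OF that] by (intro span_is_subspace) simp
  have vs: "vectorspace class_ring (vs (mat_range A))" if "A \<in> carrier_mat b m" for A
    using sub[OF that] by (rule subspace_is_vs)
  have carr: "mat_range A \<subseteq> carrier_vec b" if "A \<in> carrier_mat b m" for A
    using that by (auto simp: mat_range_def)
  have lm: "linear_map class_ring (vs (mat_range G)) (vs (mat_range (N * G))) (\<lambda>v. N *\<^sub>v v)"
  proof (intro linear_map.intro vs G NG mod_hom.intro mod_hom_axioms.intro)
    show "module class_ring (vs (mat_range G))" "module class_ring (vs (mat_range (N * G)))"
      using vs[OF G] vs[OF NG] by (auto simp: vectorspace_def)
    show "(\<lambda>v. N *\<^sub>v v) \<in> module_hom class_ring (vs (mat_range G)) (vs (mat_range (N * G)))"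
      unfolding module_hom_def
    proof (simp, intro conjI ballI allI impI)
      show "(\<lambda>v. N *\<^sub>v v) \<in> mat_range G \<rightarrow> mat_range (N * G)"
        using N G by (auto simp: mat_range_def)
      fix v w assume "v \<in> mat_range G \<and> w \<in> mat_range G"
      then show "N *\<^sub>v (v + w) = N *\<^sub>v v + N *\<^sub>v w"
        using mult_add_distrib_mat_vec[OF N(1)] carr[OF G] by blast
    next
      fix r v assume "v \<in> mat_range G"
      then show "N *\<^sub>v (r \<cdot>\<^sub>v v) = r \<cdot>\<^sub>v (N *\<^sub>v v)"
        using mult_mat_vec[OF N(1)] carr[OF G] by blast
    qed
  qed
  have inj: "inj_on (\<lambda>v. N *\<^sub>v v) (mat_range G)"
  proof (rule inj_onI)
    fix v w assume vw: "v \<in> mat_range G" "w \<in> mat_range G" "N *\<^sub>v v = N *\<^sub>v w"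
    then have "(M * N) *\<^sub>v v = (M * N) *\<^sub>v w"
      using assoc_mult_mat_vec[OF M N(1)] carr[OF G] by (metis subsetD)
    then show "v = w" using N(2) vw carr[OF G] by (metis one_mult_mat_vec subsetD)
  qed
  have surj: "(\<lambda>v. N *\<^sub>v v) ` mat_range G = mat_range (N * G)"
    using N G by (force simp: mat_range_def image_image)
  have "vectorspace.fin_dim class_ring (vs (mat_range G))"
    unfolding mat_range_eq_span[OF G] using set_cols_subset_carrier[OF G] by (intro fin_dim_span) simp_all
  then have "vectorspace.dim class_ring (vs (mat_range G)) = vectorspace.dim class_ring (vs (mat_range (N * G)))"
    using linear_map.dim_eq[OF lm] inj surj by simp
  then show ?thesis
    unfolding subspace_dim_def rank_def mat_range_eq_span[OF G] by simp
qed

text \<open>The base point \<open>c0 + N *\<^sub>v time_integral T b f\<close> is the state reached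
  with zero control, and the direction space is the range of \<open>N * G\<close>, the displacements
  that controls can add to it.\<close>

lemma reachable_affine_subspace:
  assumes T: "0 < T" and M: "M \<in> carrier_mat b b"
    and N: "N \<in> carrier_mat b b" "M * N = 1\<^sub>m b" "N * M = 1\<^sub>m b"
    and G: "G \<in> carrier_mat b m" and f: "L1_time T b f"
    and c0: "c0 \<in> carrier_vec b"
  shows "affine_subspace_of_dim b {c. reachable T b m M (\<lambda>a t. G *\<^sub>v a t + f t) c0 c} (vec_space.rank b G)"
  unfolding affine_subspace_of_dim_def
proof (intro bexI exI conjI)
  let ?I = "time_integral T b f"
  let ?p = "c0 + N *\<^sub>v ?I"
  have NG: "N * G \<in> carrier_mat b m" using N G by simp
  show "?p \<in> carrier_vec b" using c0 N by simp
  interpret vec_space "TYPE(real)" b .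
  show "VectorSpace.subspace class_ring (mat_range (N * G)) V"
    unfolding mat_range_eq_span[OF NG] using set_cols_subset_carrier[OF NG] by (intro span_is_subspace) simp
  show "subspace_dim b (mat_range (N * G)) = vec_space.rank b G"
    by (rule subspace_dim_image_mat[OF M N(1,2) G])
  have MN: "M *\<^sub>v (N *\<^sub>v v) = v" "N *\<^sub>v (M *\<^sub>v v) = v" if "v \<in> carrier_vec b" for v
    using assoc_mult_mat_vec[OF M N(1) that] assoc_mult_mat_vec[OF N(1) M that] N that by simp_all
  have "c \<in> carrier_vec b \<and> M *\<^sub>v (c - c0) - ?I \<in> mat_range G \<longleftrightarrow> c \<in> (\<lambda>w. ?p + w) ` mat_range (N * G)"
    (is "?L \<longleftrightarrow> ?R") for c
  proof
    assume c: ?L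
    then obtain u where u: "u \<in> carrier_vec m" "M *\<^sub>v (c - c0) - ?I = G *\<^sub>v u"
      using mat_range_iff[OF G] by auto
    have "M *\<^sub>v (c - c0) = ?I + (M *\<^sub>v (c - c0) - ?I)"
      using M by (intro eq_vecI) (auto simp: time_integral_def)
    then have "N *\<^sub>v (M *\<^sub>v (c - c0)) = N *\<^sub>v (?I + G *\<^sub>v u)" using u by simp
    then have d: "c - c0 = N *\<^sub>v ?I + (N * G) *\<^sub>v u"
      using MN(2)[of "c - c0"] c c0 N G u by (simp add: mult_add_distrib_mat_vec[OF N(1)])
    have "c = c0 + (c - c0)" using c c0 by auto
    also have "\<dots> = ?p + (N * G) *\<^sub>v u"
      unfolding d using c0 N G u by (intro assoc_add_vec[symmetric]) auto
    finally show ?R using u mat_range_iff[OF NG] by blast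
  next
    assume ?R
    then obtain u where u: "u \<in> carrier_vec m" "c = ?p + (N * G) *\<^sub>v u"
      using mat_range_iff[OF NG] by auto
    have c: "c \<in> carrier_vec b" using u c0 N G by simp
    have "c - c0 = N *\<^sub>v (?I + G *\<^sub>v u)"
      using u(1) c0 N G unfolding u(2)
      by (simp add: mult_add_distrib_mat_vec[OF N(1)]) (intro eq_vecI; simp)
    then have "M *\<^sub>v (c - c0) = ?I + G *\<^sub>v u" using MN(1)[of "?I + G *\<^sub>v u"] G u by simp
    then have "M *\<^sub>v (c - c0) - ?I = G *\<^sub>v u"
      using G by (intro eq_vecI) (auto simp: time_integral_def)
    then show ?L using c u mat_range_iff[OF G] by auto
  qed
  then show "{c. reachable T b m M (\<lambda>a t. G *\<^sub>v a t + f t) c0 c} = (\<lambda>w. ?p + w) ` mat_range (N * G)"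
    using reachable_iff[OF T M N G f c0] by blast
qed

text \<open>Turns surjectivity of a period map into the statement that its state space has Betti
  dimension.\<close>

lemma subspace_dim_carrier: "subspace_dim b (carrier_vec b) = b"
proof -
  interpret vec_space "TYPE(real)" b .
  have "vs (carrier_vec b) = V" by (simp add: module_vec_def)
  then have "subspace_dim b (carrier_vec b) = dim"
    unfolding subspace_dim_def by (rule arg_cong)
  then show ?thesis by (simp only: dim_is_n)
qed

section \<open>Invertibility of the harmonic mass matrices\<close>

lemma L2_material_mult:
  assumes w: "material_tensor \<Omega> w" and F: "L2 \<Omega> F"
  shows "L2 \<Omega> (\<lambda>x. w x *v F x)"
proof -
  obtain \<beta> where \<beta>: "AE x in lebesgue_on \<Omega>. \<forall>\<xi>. norm (w x *v \<xi>) \<le> \<beta> * norm \<xi>"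
    using w unfolding material_tensor_def by (metis (mono_tags, lifting) eventually_mono)
  have cont: "continuous_on UNIV (\<lambda>p :: (real^3^3) \<times> (real^3). fst p *v snd p)"
    unfolding matrix_vector_mult_def by (intro continuous_intros)
  have "(\<lambda>x. (w x, F x)) \<in> borel_measurable (lebesgue_on \<Omega>)"
    using w F by (auto simp: material_tensor_def L2_def)
  from measurable_compose[OF this borel_measurable_continuous_onI[OF cont]]
  have "(\<lambda>x. w x *v F x) \<in> borel_measurable (lebesgue_on \<Omega>)" by simp
  then show ?thesis
    by (rule L2_bound[OF F]) (use \<beta> in \<open>auto elim!: eventually_mono\<close>)
qed

section \<open>Linear combinations of harmonic fields\<close>

lemma test_function_partial_continuous:
  assumes "test_function \<Omega> \<psi>"
  shows "continuous_on UNIV (partial i \<psi>)"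
proof -
  have "Ck (Suc 0) \<psi>" using assms unfolding test_function_def by blast
  then show ?thesis by simp
qed

lemma grad_continuous:
  assumes "test_function \<Omega> \<psi>"
  shows "continuous_on UNIV (grad \<psi>)"
  unfolding grad_def by (intro continuous_on_vec_lambda test_function_partial_continuous[OF assms])

lemma curl_continuous:
  assumes "\<And>i. test_function \<Omega> (\<lambda>x. \<Psi> x $ i)"
  shows "continuous_on UNIV (curl \<Psi>)"
proof -
  have "continuous_on UNIV (\<lambda>x. curl \<Psi> x $ i)" for i
  proof -
    consider "i = 1" | "i = 2" | "i = 3" using exhaust_3[of i] by blast
    then show ?thesis
      by cases (simp_all add: curl_def vector_3 continuous_on_diff test_function_partial_continuous[OF assms])
  qed
  then have "continuous_on UNIV (\<lambda>x. \<chi> i. curl \<Psi> x $ i)" by (rule continuous_on_vec_lambda)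
  then show ?thesis by simp
qed

lemma integral_lincomb_inner:
  fixes F G H :: "'a::euclidean_space \<Rightarrow> 'b::euclidean_space"
  assumes "L2 S F" "L2 S G" "L2 S H"
  shows "(LINT x|lebesgue_on S. (r *\<^sub>R F x + s *\<^sub>R G x) \<bullet> H x)
    = r * (LINT x|lebesgue_on S. F x \<bullet> H x) + s * (LINT x|lebesgue_on S. G x \<bullet> H x)"
  using L2_integrable_inner[OF assms(1,3)] L2_integrable_inner[OF assms(2,3)]
  by (simp add: inner_add_left)

lemma weighted_inner_lincomb:
  assumes w: "material_tensor \<Omega> w" and L: "L2 \<Omega> F" "L2 \<Omega> G" "L2 \<Omega> H"
  shows "weighted_inner \<Omega> w (\<lambda>x. r *\<^sub>R F x + s *\<^sub>R G x) H
    = r * weighted_inner \<Omega> w F H + s * weighted_inner \<Omega> w G H"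
  unfolding weighted_inner_def
  using integral_lincomb_inner[OF L2_material_mult[OF w L(1)] L2_material_mult[OF w L(2)] L(3), of r s]
  by (simp add: matrix_vector_right_distrib matrix_vector_mult_scaleR)

text \<open>The integral of a non-integrable function is 0 by convention, so splitting the weak
  equation needs integrability of each pairing. It follows from square-integrability of the fields
  and, on a bounded domain, of the continuous curl of a test field.\<close>

lemma harmonic1_lincomb:
  assumes \<Omega>: "\<Omega> \<in> lmeasurable" "bounded \<Omega>" and w: "material_tensor \<Omega> w"
    and F: "F \<in> harmonic1 \<Omega> w" and G: "G \<in> harmonic1 \<Omega> w"
  shows "(\<lambda>x. r *\<^sub>R F x + s *\<^sub>R G x) \<in> harmonic1 \<Omega> w"
proof -
  have L: "L2 \<Omega> F" "L2 \<Omega> G" using F G by (auto simp: harmonic1_def)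
  have "weak_curl \<Omega> (\<lambda>x. r *\<^sub>R F x + s *\<^sub>R G x) (\<lambda>x. 0)"
    unfolding weak_curl_def
  proof (intro allI impI)
    fix \<Psi> :: "real^3 \<Rightarrow> real^3" assume \<Psi>: "\<forall>i. test_function \<Omega> (\<lambda>x. \<Psi> x $ i)"
    have "L2 \<Omega> (curl \<Psi>)"
      using \<Psi> by (intro L2_continuous[OF \<Omega>] curl_continuous) auto
    then show "(LINT x|lebesgue_on \<Omega>. (r *\<^sub>R F x + s *\<^sub>R G x) \<bullet> curl \<Psi> x) = (LINT x|lebesgue_on \<Omega>. 0 \<bullet> \<Psi> x)"
      using F G \<Psi> integral_lincomb_inner[OF L, of "curl \<Psi>" r s]
      by (simp add: harmonic1_def weak_curl_def)
  qed
  moreover have "weighted_inner \<Omega> w (\<lambda>x. r *\<^sub>R F x + s *\<^sub>R G x) C = 0"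
    if C: "L2 \<Omega> \<phi>" "L2 \<Omega> C" "weak_grad \<Omega> \<phi> C" for \<phi> C
  proof -
    have "weighted_inner \<Omega> w F C = 0" "weighted_inner \<Omega> w G C = 0"
      using F G C unfolding harmonic1_def by blast+
    then show ?thesis by (simp add: weighted_inner_lincomb[OF w L C(2)])
  qed
  ultimately show ?thesis
    using L2_add[OF L2_scaleR[OF L(1)] L2_scaleR[OF L(2)]] unfolding harmonic1_def by blast
qed

lemma harmonic2_lincomb:
  assumes \<Omega>: "\<Omega> \<in> lmeasurable" "bounded \<Omega>" and w: "material_tensor \<Omega> w"
    and F: "F \<in> harmonic2 \<Omega> w" and G: "G \<in> harmonic2 \<Omega> w"
  shows "(\<lambda>x. r *\<^sub>R F x + s *\<^sub>R G x) \<in> harmonic2 \<Omega> w"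
proof -
  have L: "L2 \<Omega> F" "L2 \<Omega> G" using F G by (auto simp: harmonic2_def)
  have "weak_div \<Omega> (\<lambda>x. r *\<^sub>R F x + s *\<^sub>R G x) (\<lambda>x. 0)"
    unfolding weak_div_def
  proof (intro allI impI)
    fix \<psi> assume \<psi>: "test_function \<Omega> \<psi>"
    have "L2 \<Omega> (grad \<psi>)"
      using \<psi> by (intro L2_continuous[OF \<Omega>] grad_continuous) auto
    then show "(LINT x|lebesgue_on \<Omega>. (r *\<^sub>R F x + s *\<^sub>R G x) \<bullet> grad \<psi> x) = - (LINT x|lebesgue_on \<Omega>. 0 * \<psi> x)"
      using F G \<psi> integral_lincomb_inner[OF L, of "grad \<psi>" r s]
      by (simp add: harmonic2_def weak_div_def)
  qed
  moreover have "weighted_inner \<Omega> w (\<lambda>x. r *\<^sub>R F x + s *\<^sub>R G x) C = 0"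
    if C: "L2 \<Omega> A" "L2 \<Omega> C" "weak_curl \<Omega> A C" for A C
  proof -
    have "weighted_inner \<Omega> w F C = 0" "weighted_inner \<Omega> w G C = 0"
      using F G C unfolding harmonic2_def by blast+
    then show ?thesis by (simp add: weighted_inner_lincomb[OF w L C(2)])
  qed
  ultimately show ?thesis
    using L2_add[OF L2_scaleR[OF L(1)] L2_scaleR[OF L(2)]] unfolding harmonic2_def by blast
qed

text \<open>\<open>V\<close> is kept abstract so that one energy argument serves degrees one and
  two. The energy of the field with periods \<open>v\<close> is the quadratic form of the mass
  matrix at \<open>v\<close>.\<close>

lemma harmonic_mass_injective:
  fixes V :: "(real^3 \<Rightarrow> real^3) set"
  assumes w: "material_tensor \<Omega> w"
    and VL2: "\<And>F. F \<in> V \<Longrightarrow> L2 \<Omega> F"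
    and lin: "\<And>F G r s. F \<in> V \<Longrightarrow> G \<in> V \<Longrightarrow> (\<lambda>x. r *\<^sub>R F x + s *\<^sub>R G x) \<in> V"
    and P: "period_map \<Omega> V b P" and H: "reconstruction V b P H"
    and v: "v \<in> carrier_vec b" and Mv: "harmonic_mass \<Omega> w b H *\<^sub>v v = 0\<^sub>v b"
  shows "v = 0\<^sub>v b"
proof -
  let ?M = "harmonic_mass \<Omega> w b H"
  define h where "h k = H (unit_vec b k)" for k
  have h: "h k \<in> V" "P (h k) = unit_vec b k" if "k < b" for k
    using H that by (auto simp: reconstruction_def h_def)
  have Plin: "P (\<lambda>x. r *\<^sub>R F x + s *\<^sub>R G x) = r \<cdot>\<^sub>v P F + s \<cdot>\<^sub>v P G" if "F \<in> V" "G \<in> V" for F G r s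
    using P that by (simp add: period_map_def)
  have Pcarr: "P F \<in> carrier_vec b" if "F \<in> V" for F
    using P that by (auto simp: period_map_def)
  have "P ` V = carrier_vec b" using P by (simp add: period_map_def)
  \<comment> \<open>Any element of \<open>V\<close> will do: it puts the zero field into
    \<open>V\<close> and starts the induction below, even for \<open>b = 0\<close>.\<close>
  then obtain F0 where F0: "F0 \<in> V" using v by blast
  \<comment> \<open>\<open>H\<close> need not be linear on the nose, so \<open>H v\<close> is replaced by this combination, which has the same periods.\<close>
  define S where "S n x = (\<Sum>k<n. vec_index v k *\<^sub>R h k x)" for n x
  \<comment> \<open>Linearity of \<open>P\<close> is given for two summands and on \<open>V\<close>
    only, so membership in \<open>V\<close> and the periods of the partial sums are carried
    together.\<close>
  have S: "S n \<in> V \<and> P (S n) = Matrix.vec b (\<lambda>i. if i < n then vec_index v i else 0)" if "n \<le> b" for n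
    using that
  proof (induction n)
    case 0
    have "S 0 = (\<lambda>x. 0 *\<^sub>R F0 x + 0 *\<^sub>R F0 x)" by (auto simp: S_def)
    then show ?case
      using lin[OF F0 F0, of 0 0] Plin[OF F0 F0, of 0 0] Pcarr[OF F0] by (auto intro!: eq_vecI)
  next
    case (Suc n)
    have eq: "S (Suc n) = (\<lambda>x. 1 *\<^sub>R S n x + vec_index v n *\<^sub>R h n x)" by (auto simp: S_def)
    have n: "S n \<in> V" "P (S n) = Matrix.vec b (\<lambda>i. if i < n then vec_index v i else 0)" "n < b"
      using Suc by auto
    show ?case
      unfolding eq using lin[OF n(1) h(1)[OF n(3)], of 1 "vec_index v n"]
        Plin[OF n(1) h(1)[OF n(3)], of 1 "vec_index v n"] n(2,3) h(2)[OF n(3)]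
      by (auto intro!: eq_vecI simp: less_Suc_eq)
  qed
  have F: "S b \<in> V" "P (S b) = v"
    using S[of b] v by (auto intro!: eq_vecI)
  have L: "L2 \<Omega> (h k)" if "k < b" for k using VL2 h that by blast
  have Lw: "L2 \<Omega> (\<lambda>x. w x *v h k x)" if "k < b" for k using L2_material_mult[OF w L[OF that]] .
  have inner: "integrable (lebesgue_on \<Omega>) (\<lambda>x. (w x *v h k x) \<bullet> h l x)" if "k < b" "l < b" for k l
    using L2_integrable_inner[OF Lw L] that by blast
  have expand: "(w x *v S b x) \<bullet> S b x
      = (\<Sum>l<b. vec_index v l * (\<Sum>k<b. ((w x *v h k x) \<bullet> h l x) * vec_index v k))" for x
  proof -
    have "w x *v S b x = (\<Sum>k<b. vec_index v k *\<^sub>R (w x *v h k x))"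
      unfolding S_def
      by (simp add: linear_sum[OF matrix_vector_mul_linear] matrix_vector_mult_scaleR)
    then show ?thesis
      by (simp add: S_def inner_sum_left inner_sum_right sum_distrib_left mult_ac)
  qed
  have "(LINT x|lebesgue_on \<Omega>. (w x *v S b x) \<bullet> S b x)
      = (\<Sum>l<b. vec_index v l * (\<Sum>k<b. (LINT x|lebesgue_on \<Omega>. (w x *v h k x) \<bullet> h l x) * vec_index v k))"
    unfolding expand
  proof (subst Bochner_Integration.integral_sum)
    have int: "integrable (lebesgue_on \<Omega>) (\<lambda>x. ((w x *v h k x) \<bullet> h l x) * vec_index v k)"
      if "k \<in> {..<b}" "l \<in> {..<b}" for k l
      using inner that by (intro Bochner_Integration.integrable_mult_left) auto
    show "integrable (lebesgue_on \<Omega>)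
        (\<lambda>x. vec_index v l * (\<Sum>k<b. ((w x *v h k x) \<bullet> h l x) * vec_index v k))" if "l \<in> {..<b}" for l
      using int that by (intro Bochner_Integration.integrable_mult_right Bochner_Integration.integrable_sum) auto
    show "(\<Sum>l<b. LINT x|lebesgue_on \<Omega>. vec_index v l * (\<Sum>k<b. ((w x *v h k x) \<bullet> h l x) * vec_index v k))
      = (\<Sum>l<b. vec_index v l * (\<Sum>k<b. (LINT x|lebesgue_on \<Omega>. (w x *v h k x) \<bullet> h l x) * vec_index v k))"
    proof (rule sum.cong[OF refl])
      fix l assume l: "l \<in> {..<b}"
      have "(LINT x|lebesgue_on \<Omega>. (\<Sum>k<b. ((w x *v h k x) \<bullet> h l x) * vec_index v k))
          = (\<Sum>k<b. LINT x|lebesgue_on \<Omega>. ((w x *v h k x) \<bullet> h l x) * vec_index v k)"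
        by (rule Bochner_Integration.integral_sum) (rule int[OF _ l])
      then show "(LINT x|lebesgue_on \<Omega>. vec_index v l * (\<Sum>k<b. ((w x *v h k x) \<bullet> h l x) * vec_index v k))
          = vec_index v l * (\<Sum>k<b. (LINT x|lebesgue_on \<Omega>. (w x *v h k x) \<bullet> h l x) * vec_index v k)"
        by simp
    qed
  qed
  \<comment> \<open>The integral pairing \<open>w x *v h k x\<close> with \<open>h l x\<close> is
    the mass matrix entry in row \<open>l\<close> and column \<open>k\<close>.\<close>
  also have "\<dots> = (\<Sum>l<b. vec_index v l * vec_index (?M *\<^sub>v v) l)"
    using v by (auto simp: harmonic_mass_def recon_adjoint_def h_def scalar_prod_def atLeast0LessThan
        intro!: sum.cong arg_cong2[of _ _ _ _ "(*)"])
  also have "\<dots> = 0" unfolding Mv by simp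
  finally have int0: "(LINT x|lebesgue_on \<Omega>. (w x *v S b x) \<bullet> S b x) = 0" .
  obtain \<alpha> where \<alpha>: "\<alpha> > 0" "AE x in lebesgue_on \<Omega>. \<forall>\<xi>. \<alpha> * (norm \<xi>)\<^sup>2 \<le> (w x *v \<xi>) \<bullet> \<xi>"
    using w unfolding material_tensor_def by (metis (mono_tags, lifting) eventually_mono)
  have pos: "AE x in lebesgue_on \<Omega>. 0 \<le> (w x *v S b x) \<bullet> S b x"
    using \<alpha>(2) by eventually_elim (meson \<alpha>(1) mult_nonneg_nonneg order_less_imp_le order_trans zero_le_power2)
  have "AE x in lebesgue_on \<Omega>. (w x *v S b x) \<bullet> S b x = 0"
    using integral_nonneg_eq_0_iff_AE[OF L2_integrable_inner[OF L2_material_mult[OF w VL2[OF F(1)]] VL2[OF F(1)]] pos]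
      int0 by simp
  \<comment> \<open>Coercivity turns a vanishing energy density into a vanishing field, whose
    periods are then zero.\<close>
  with \<alpha>(2) have "AE x in lebesgue_on \<Omega>. S b x = 0"
  proof eventually_elim
    case (elim x)
    then have "\<alpha> * (norm (S b x))\<^sup>2 \<le> 0" by metis
    then show ?case using \<alpha>(1) by (simp add: mult_le_0_iff)
  qed
  then have "P (S b) = 0\<^sub>v b"
    using P F(1) unfolding period_map_def by blast
  then show ?thesis using F(2) by simp
qed

section \<open>Pointwise inversion of material tensors\<close>

lemma borel_measurable_vec_components:
  fixes f :: "'a \<Rightarrow> real^'n^'m"
  assumes "\<And>i j. (\<lambda>x. f x $ i $ j) \<in> borel_measurable M"
  shows "f \<in> borel_measurable M"
proof (subst borel_measurable_euclidean_space, intro ballI)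
  fix b :: "real^'n^'m" assume "b \<in> Basis"
  then obtain i j where "b = axis i (axis j 1)" by (auto simp: Basis_vec_def)
  then show "(\<lambda>x. f x \<bullet> b) \<in> borel_measurable M" using assms[of i j] by (simp add: inner_axis)
qed

lemma borel_measurable_det:
  fixes f :: "'a \<Rightarrow> real^'n^'n"
  assumes "\<And>i j. (\<lambda>x. f x $ i $ j) \<in> borel_measurable M"
  shows "(\<lambda>x. Determinants.det (f x)) \<in> borel_measurable M"
  unfolding Determinants.det_def using assms by measurable

lemma matrix_inv_inverse:
  fixes A :: "real^'n^'n"
  assumes "invertible A"
  shows "A ** matrix_inv A = Finite_Cartesian_Product.mat 1" "matrix_inv A ** A = Finite_Cartesian_Product.mat 1"
proof -
  have "A ** matrix_inv A = Finite_Cartesian_Product.mat 1 \<and> matrix_inv A ** A = Finite_Cartesian_Product.mat 1"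
    unfolding matrix_inv_def using assms unfolding invertible_def by (rule someI_ex)
  then show "A ** matrix_inv A = Finite_Cartesian_Product.mat 1" "matrix_inv A ** A = Finite_Cartesian_Product.mat 1" by auto
qed

text \<open>Composed with a measurable tensor, this gives measurability of the inverse tensor.
  Singular matrices must be included, since the tensor is controlled only almost everywhere.\<close>

lemma borel_measurable_matrix_inv: "(matrix_inv :: real^'n^'n \<Rightarrow> real^'n^'n) \<in> borel_measurable borel"
proof (rule borel_measurable_vec_components)
  fix k l :: 'n
  \<comment> \<open>On singular matrices \<open>matrix_inv\<close> is the constant \<open>SOME _. False\<close>; elsewhere Cramer's rule applies.\<close>
  define C :: "real^'n^'n" where "C = (SOME _. False)"
  define R where "R A = (\<chi> i j. if j = k then axis l 1 $ i else A $ i $ j)" for A :: "real^'n^'n"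
  have "matrix_inv A $ k $ l
      = (if Determinants.det A = 0 then C $ k $ l else Determinants.det (R A) / Determinants.det A)" for A
  proof (cases "Determinants.det A = 0")
    case True
    then have "\<not> invertible A" by (simp add: invertible_det_nz)
    then have "(\<lambda>B. A ** B = Finite_Cartesian_Product.mat 1 \<and> B ** A = Finite_Cartesian_Product.mat 1) = (\<lambda>_. False)"
      by (auto simp: invertible_def)
    then show ?thesis using True by (simp add: matrix_inv_def C_def)
  next
    case False
    then have "invertible A" by (simp add: invertible_det_nz)
    then have "A *v (matrix_inv A *v axis l 1) = axis l 1"
      by (simp add: matrix_vector_mul_assoc matrix_inv_inverse)
    then have "matrix_inv A *v axis l 1
        = (\<chi> k. Determinants.det (\<chi> i j. if j = k then axis l 1 $ i else A $ i $ j) / Determinants.det A)"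
      using cramer[OF False] by blast
    moreover have "(matrix_inv A *v axis l 1) $ k = matrix_inv A $ k $ l"
      by (simp add: matrix_vector_mult_def axis_def if_distrib[where f = "\<lambda>y. _ * y"] cong: if_cong)
    ultimately show ?thesis using False by (simp add: R_def)
  qed
  moreover have comp: "(\<lambda>A. A $ i $ j) \<in> borel_measurable (borel :: (real^'n^'n) measure)" for i j
    by (intro borel_measurable_continuous_onI continuous_intros)
  then have "(\<lambda>A. R A $ i $ j) \<in> borel_measurable borel" for i j
    by (cases "j = k") (auto simp: R_def)
  ultimately show "(\<lambda>A :: real^'n^'n. matrix_inv A $ k $ l) \<in> borel_measurable borel"
    using borel_measurable_det[OF comp] borel_measurable_det[of R borel] by simp
qed

text \<open>Both bounds come from coercivity at \<open>B *v \<xi>\<close>, where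
  \<open>A *v (B *v \<xi>) = \<xi>\<close>. The upper bound of \<open>A\<close> then turns the norm
  of \<open>B *v \<xi>\<close> into that of \<open>\<xi>\<close> for the lower estimate;
  Cauchy-Schwarz gives the upper one.\<close>

lemma material_tensor_matrix_inv:
  assumes "material_tensor \<Omega> w"
  shows "material_tensor \<Omega> (\<lambda>x. matrix_inv (w x))"
proof -
  obtain \<alpha> \<beta> where \<alpha>: "\<alpha> > 0" and ae: "AE x in lebesgue_on \<Omega>.
        transpose (w x) = w x \<and>
        (\<forall>\<xi>. \<alpha> * (norm \<xi>)\<^sup>2 \<le> (w x *v \<xi>) \<bullet> \<xi>) \<and>
        (\<forall>\<xi>. norm (w x *v \<xi>) \<le> \<beta> * norm \<xi>)"
    and m: "w \<in> borel_measurable (lebesgue_on \<Omega>)"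
    using assms unfolding material_tensor_def by blast
  \<comment> \<open>The given bound \<open>\<beta>\<close> need not be positive; its maximum with 1
    can be divided by.\<close>
  define \<gamma> where "\<gamma> = max \<beta> 1"
  show ?thesis
    unfolding material_tensor_def
  proof (intro conjI exI)
    show "(\<lambda>x. matrix_inv (w x)) \<in> borel_measurable (lebesgue_on \<Omega>)"
      using m borel_measurable_matrix_inv by (rule measurable_compose)
    show "\<alpha> / \<gamma>\<^sup>2 > 0" using \<alpha> by (simp add: \<gamma>_def)
    show "AE x in lebesgue_on \<Omega>.
        transpose (matrix_inv (w x)) = matrix_inv (w x) \<and>
        (\<forall>\<xi>. \<alpha> / \<gamma>\<^sup>2 * (norm \<xi>)\<^sup>2 \<le> (matrix_inv (w x) *v \<xi>) \<bullet> \<xi>) \<and>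
        (\<forall>\<xi>. norm (matrix_inv (w x) *v \<xi>) \<le> 1 / \<alpha> * norm \<xi>)"
      using ae
    proof (rule AE_mp, intro AE_I2 impI)
      fix x
      define A where "A = w x"
      define B where "B = matrix_inv A"
      assume "transpose (w x) = w x \<and>
        (\<forall>\<xi>. \<alpha> * (norm \<xi>)\<^sup>2 \<le> (w x *v \<xi>) \<bullet> \<xi>) \<and>
        (\<forall>\<xi>. norm (w x *v \<xi>) \<le> \<beta> * norm \<xi>)"
      then have A: "transpose A = A" "\<And>\<xi>. \<alpha> * (norm \<xi>)\<^sup>2 \<le> (A *v \<xi>) \<bullet> \<xi>"
        "\<And>\<xi>. norm (A *v \<xi>) \<le> \<beta> * norm \<xi>" by (auto simp: A_def)
      have "\<xi> = 0" if "A *v \<xi> = 0" for \<xi>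
        using A(2)[of \<xi>] \<alpha> that by (simp add: mult_le_0_iff)
      then have "invertible A"
        unfolding invertible_left_inverse matrix_left_invertible_ker by blast
      then have B: "A ** B = Finite_Cartesian_Product.mat 1" "B ** A = Finite_Cartesian_Product.mat 1"
        by (simp_all add: B_def matrix_inv_inverse)
      \<comment> \<open>By symmetry of \<open>A\<close>, the transpose of \<open>B\<close> is again
        a left inverse of \<open>A\<close>, hence equal to \<open>B\<close>.\<close>
      have "transpose B ** A = Finite_Cartesian_Product.mat 1"
        using arg_cong[OF B(1), of transpose] A(1) by (simp add: matrix_transpose_mul Finite_Cartesian_Product.transpose_mat)
      then have "transpose B ** (A ** B) = B"
        by (simp add: matrix_mul_assoc)
      then have sym: "transpose B = B" using B(1) by simp
      have AB: "A *v (B *v \<xi>) = \<xi>" for \<xi> using B(1) by (simp add: matrix_vector_mul_assoc)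
      have low: "\<alpha> / \<gamma>\<^sup>2 * (norm \<xi>)\<^sup>2 \<le> (B *v \<xi>) \<bullet> \<xi>" for \<xi>
      proof -
        have "norm \<xi> \<le> \<beta> * norm (B *v \<xi>)" using A(3)[of "B *v \<xi>"] AB by simp
        also have "\<dots> \<le> \<gamma> * norm (B *v \<xi>)" by (intro mult_right_mono) (auto simp: \<gamma>_def)
        finally have "(norm \<xi>)\<^sup>2 \<le> (\<gamma> * norm (B *v \<xi>))\<^sup>2" by (intro power_mono) auto
        then have "\<alpha> / \<gamma>\<^sup>2 * (norm \<xi>)\<^sup>2 \<le> \<alpha> / \<gamma>\<^sup>2 * (\<gamma> * norm (B *v \<xi>))\<^sup>2"
          using \<alpha> by (intro mult_left_mono) auto
        also have "\<dots> = \<alpha> * (norm (B *v \<xi>))\<^sup>2"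
          by (simp add: \<gamma>_def power_mult_distrib)
        also have "\<dots> \<le> (B *v \<xi>) \<bullet> \<xi>" using A(2)[of "B *v \<xi>"] AB by (simp add: inner_commute)
        finally show ?thesis .
      qed
      have up: "norm (B *v \<xi>) \<le> 1 / \<alpha> * norm \<xi>" for \<xi>
      proof (cases "norm (B *v \<xi>) = 0")
        case False
        have "\<alpha> * (norm (B *v \<xi>))\<^sup>2 \<le> \<xi> \<bullet> (B *v \<xi>)" using A(2)[of "B *v \<xi>"] AB by simp
        also have "\<dots> \<le> norm \<xi> * norm (B *v \<xi>)" by (rule norm_cauchy_schwarz)
        finally have "\<alpha> * norm (B *v \<xi>) \<le> norm \<xi>" using False by (simp add: power2_eq_square)
        then show ?thesis using \<alpha> by (simp add: field_simps)
      qed (use \<alpha> in simp)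
      show "transpose (matrix_inv (w x)) = matrix_inv (w x) \<and>
        (\<forall>\<xi>. \<alpha> / \<gamma>\<^sup>2 * (norm \<xi>)\<^sup>2 \<le> (matrix_inv (w x) *v \<xi>) \<bullet> \<xi>) \<and>
        (\<forall>\<xi>. norm (matrix_inv (w x) *v \<xi>) \<le> 1 / \<alpha> * norm \<xi>)"
        using sym low up unfolding A_def[symmetric] B_def[symmetric] by blast
    qed
  qed
qed

section \<open>Harmonic currents\<close>

text \<open>The pairing of the current with a fixed harmonic field is integrable on the space-time
  cylinder, so Fubini makes its spatial integral integrable in time.\<close>

lemma L1_time_recon_adjoint_current:
  assumes \<Omega>: "\<Omega> \<in> lmeasurable" and j: "L2_time_L2 T \<Omega> j"
    and h: "\<And>i. i < b \<Longrightarrow> L2 \<Omega> (H (unit_vec b i))"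
  shows "L1_time T b (\<lambda>t. recon_adjoint \<Omega> b H (j t))"
  unfolding L1_time_def
proof (intro conjI allI impI)
  show "recon_adjoint \<Omega> b H (j t) \<in> carrier_vec b" for t by (simp add: recon_adjoint_def)
  fix i assume i: "i < b"
  let ?A = "lebesgue_on {0..T}" and ?B = "lebesgue_on \<Omega>"
  define k where "k = H (unit_vec b i)"
  have k: "L2 \<Omega> k" using h[OF i] by (simp add: k_def)
  interpret A: finite_measure ?A by (rule finite_measure_lebesgue_on) simp
  interpret B: finite_measure ?B by (rule finite_measure_lebesgue_on[OF \<Omega>])
  interpret pair_sigma_finite ?A ?B ..
  have km: "k \<in> borel_measurable ?B" using k by (simp add: L2_def)
  have k2: "(\<lambda>p. k (snd p)) \<in> borel_measurable (?A \<Otimes>\<^sub>M ?B)"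
    by (rule measurable_compose[OF measurable_snd km])
  have jm: "(\<lambda>p. j (fst p) (snd p)) \<in> borel_measurable (?A \<Otimes>\<^sub>M ?B)"
    and ji: "integrable (?A \<Otimes>\<^sub>M ?B) (\<lambda>p. (norm (j (fst p) (snd p)))\<^sup>2)"
    using j by (auto simp: L2_time_L2_def split_def)
  \<comment> \<open>A time-independent square-integrable field is square-integrable on the cylinder
    because the time interval has finite measure.\<close>
  have ki: "integrable (?A \<Otimes>\<^sub>M ?B) (\<lambda>p. (norm (k (snd p)))\<^sup>2)"
  proof (rule Fubini_integrable)
    show "(\<lambda>p. (norm (k (snd p)))\<^sup>2) \<in> borel_measurable (?A \<Otimes>\<^sub>M ?B)" using k2 by measurable
  qed (use k in \<open>auto simp: L2_def\<close>)
  have "integrable (?A \<Otimes>\<^sub>M ?B) (\<lambda>p. (norm (j (fst p) (snd p)))\<^sup>2 + (norm (k (snd p)))\<^sup>2)"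
    using ji ki by simp
  then have "integrable (?A \<Otimes>\<^sub>M ?B) (\<lambda>p. j (fst p) (snd p) \<bullet> k (snd p))"
  proof (rule Bochner_Integration.integrable_bound)
    show "(\<lambda>p. j (fst p) (snd p) \<bullet> k (snd p)) \<in> borel_measurable (?A \<Otimes>\<^sub>M ?B)"
      using jm k2 by (rule borel_measurable_inner)
    show "AE p in ?A \<Otimes>\<^sub>M ?B. norm (j (fst p) (snd p) \<bullet> k (snd p))
        \<le> norm ((norm (j (fst p) (snd p)))\<^sup>2 + (norm (k (snd p)))\<^sup>2)"
      using abs_inner_le_sum_squares by (intro AE_I2) (simp add: order_trans[OF _ abs_ge_self])
  qed
  from integrable_fst'[OF this] show "integrable ?A (\<lambda>t. vec_index (recon_adjoint \<Omega> b H (j t)) i)"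
    using i by (simp add: recon_adjoint_def k_def)
qed

text \<open>Joint measurability of \<open>\<B> (z t) x\<close> in \<open>t\<close> and
  \<open>x\<close> is not among the assumptions, so Fubini is replaced by duality: pairing
  \<open>\<B> u\<close> with a fixed harmonic field is a bounded linear functional of
  \<open>u\<close>, and a continuous function of the measurable \<open>z\<close> is
  measurable.\<close>

lemma L1_time_recon_adjoint_control:
  fixes \<B> :: "'z::{real_inner, complete_space} \<Rightarrow> real^3 \<Rightarrow> real^3"
  assumes \<B>: "distributed_control_operator \<Omega> \<B>" and z: "distributed_control T z"
    and h: "\<And>i. i < b \<Longrightarrow> L2 \<Omega> (H (unit_vec b i))"
  shows "L1_time T b (\<lambda>t. recon_adjoint \<Omega> b H (\<B> (z t)))"
  unfolding L1_time_def
proof (intro conjI allI impI)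
  show "recon_adjoint \<Omega> b H (\<B> (z t)) \<in> carrier_vec b" for t by (simp add: recon_adjoint_def)
  fix i assume i: "i < b"
  define k where "k = H (unit_vec b i)"
  have k: "L2 \<Omega> k" using h[OF i] by (simp add: k_def)
  have BL: "L2 \<Omega> (\<B> u)" for u using \<B> by (simp add: distributed_control_operator_def)
  have BAE: "AE x in lebesgue_on \<Omega>. \<B> (r *\<^sub>R u + s *\<^sub>R v) x = r *\<^sub>R \<B> u x + s *\<^sub>R \<B> v x" for u v r s
    using \<B> by (simp add: distributed_control_operator_def)
  obtain K where K: "\<And>u. (LINT x|lebesgue_on \<Omega>. (norm (\<B> u x))\<^sup>2) \<le> K * (norm u)\<^sup>2"
    using \<B> by (auto simp: distributed_control_operator_def)
  define \<Lambda> where "\<Lambda> u = (LINT x|lebesgue_on \<Omega>. \<B> u x \<bullet> k x)" for u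
  \<comment> \<open>\<open>\<B>\<close> is linear only up to null sets that depend on the arguments;
    integration removes them, so \<open>\<Lambda>\<close> is exactly linear.\<close>
  have comb: "\<Lambda> (r *\<^sub>R u + s *\<^sub>R v) = r * \<Lambda> u + s * \<Lambda> v" for r s u v
  proof -
    have "\<Lambda> (r *\<^sub>R u + s *\<^sub>R v) = (LINT x|lebesgue_on \<Omega>. (r *\<^sub>R \<B> u x + s *\<^sub>R \<B> v x) \<bullet> k x)"
      unfolding \<Lambda>_def
    proof (rule integral_cong_AE)
      show "(\<lambda>x. \<B> (r *\<^sub>R u + s *\<^sub>R v) x \<bullet> k x) \<in> borel_measurable (lebesgue_on \<Omega>)"
        using L2_integrable_inner[OF BL k] by blast
      show "(\<lambda>x. (r *\<^sub>R \<B> u x + s *\<^sub>R \<B> v x) \<bullet> k x) \<in> borel_measurable (lebesgue_on \<Omega>)"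
        using L2_integrable_inner[OF L2_add[OF L2_scaleR[OF BL] L2_scaleR[OF BL]] k] by blast
      show "AE x in lebesgue_on \<Omega>. \<B> (r *\<^sub>R u + s *\<^sub>R v) x \<bullet> k x = (r *\<^sub>R \<B> u x + s *\<^sub>R \<B> v x) \<bullet> k x"
        using BAE[of r u s v] by eventually_elim simp
    qed
    then show ?thesis
      using integral_lincomb_inner[OF BL BL k, of r u s v] by (simp add: \<Lambda>_def)
  qed
  have lin: "linear \<Lambda>"
    using comb[of 1 _ 1] comb[of _ _ 0] by (intro linearI) (metis add.right_neutral mult_1 mult_zero_left real_scaleR_def scaleR_one scale_zero_left)+
  \<comment> \<open>On a unit vector the crude inner product bound gives the operator constant
    \<open>K\<close> plus the squared norm of the harmonic field.\<close>
  define C where "C = K + (LINT x|lebesgue_on \<Omega>. (norm (k x))\<^sup>2)"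
  have bound: "\<bar>\<Lambda> u\<bar> \<le> C * norm u" for u
  proof (cases "u = 0")
    case False
    define e where "e = (1 / norm u) *\<^sub>R u"
    have e: "norm e = 1" "u = norm u *\<^sub>R e" using False by (auto simp: e_def)
    have "\<bar>\<Lambda> e\<bar> \<le> C"
      using L2_abs_integral_inner_le[OF BL k, of e] K[of e] e(1) by (simp add: \<Lambda>_def C_def)
    moreover have "\<Lambda> u = norm u * \<Lambda> e" using linear_scale[OF lin, of "norm u" e] e(2) by simp
    ultimately show ?thesis
      by (simp add: abs_mult mult.commute[of C] mult_left_mono)
  qed (simp add: linear_0[OF lin])
  then have "bounded_linear \<Lambda>"
    using lin by (intro bounded_linear_intro[where K = C]) (auto simp: linear_add linear_scale mult.commute)
  then have "continuous_on UNIV \<Lambda>" by (rule linear_continuous_on)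
  moreover have zm: "z \<in> borel_measurable (lebesgue_on {0..T})"
    and zi: "integrable (lebesgue_on {0..T}) (\<lambda>t. (norm (z t))\<^sup>2)"
    using z by (auto simp: distributed_control_def)
  ultimately have m: "(\<lambda>t. \<Lambda> (z t)) \<in> borel_measurable (lebesgue_on {0..T})"
    using measurable_compose[OF zm borel_measurable_continuous_onI] by blast
  have "L2 {0..T} (\<lambda>t. \<Lambda> (z t))"
    unfolding L2_def
  proof
    have "integrable (lebesgue_on {0..T}) (\<lambda>t. C\<^sup>2 * (norm (z t))\<^sup>2)" using zi by simp
    then show "integrable (lebesgue_on {0..T}) (\<lambda>t. (norm (\<Lambda> (z t)))\<^sup>2)"
    proof (rule Bochner_Integration.integrable_bound)
      show "AE t in lebesgue_on {0..T}. norm ((norm (\<Lambda> (z t)))\<^sup>2) \<le> norm (C\<^sup>2 * (norm (z t))\<^sup>2)"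
      proof (rule AE_I2)
        fix t
        have "\<bar>\<Lambda> (z t)\<bar>\<^sup>2 \<le> (C * norm (z t))\<^sup>2" using bound by (intro power_mono) auto
        then show "norm ((norm (\<Lambda> (z t)))\<^sup>2) \<le> norm (C\<^sup>2 * (norm (z t))\<^sup>2)"
          by (simp add: power_mult_distrib)
      qed
    qed (intro borel_measurable_power measurable_compose[OF m borel_measurable_norm])
  qed (rule m)
  then have "integrable (lebesgue_on {0..T}) (\<lambda>t. \<Lambda> (z t))"
    by (rule L2_imp_integrable) simp
  then show "integrable (lebesgue_on {0..T}) (\<lambda>t. vec_index (recon_adjoint \<Omega> b H (\<B> (z t))) i)"
    using i by (simp add: recon_adjoint_def \<Lambda>_def k_def)
qed

theorem proposition5p2:
  fixes T :: real
    and \<Omega> :: "(real^3) set"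
    and \<epsilon> \<mu> :: "real^3 \<Rightarrow> real^3^3"
    and b1 b2 mE mB :: nat
    and P_E P_B :: "(real^3 \<Rightarrow> real^3) \<Rightarrow> real vec"
    and H_E H_B :: "real vec \<Rightarrow> real^3 \<Rightarrow> real^3"
    and M_E M_B G_E G_B :: "real mat"
    and g_E g_B :: "real \<Rightarrow> real vec"
    and j :: "real \<Rightarrow> real^3 \<Rightarrow> real^3"
    and \<B> :: "'z::{real_inner, complete_space} \<Rightarrow> real^3 \<Rightarrow> real^3"
    and z :: "real \<Rightarrow> 'z"
    and j_H C_Ez :: "real \<Rightarrow> real vec"
    and cE0 cET cB0 cBT :: "real vec"
  assumes T: "T > 0"
    and domain: "bounded \<Omega>" "lipschitz_domain \<Omega>"
    and material: "material_tensor \<Omega> \<epsilon>" "material_tensor \<Omega> \<mu>"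
    and betti: "b1 = betti 1 \<Omega>" "b2 = betti 2 \<Omega>"
    and periods: "period_map \<Omega> (harmonic1 \<Omega> \<epsilon>) b1 P_E"
      "period_map \<Omega> (harmonic2 \<Omega> (\<lambda>x. matrix_inv (\<mu> x))) b2 P_B"
    and recon: "reconstruction (harmonic1 \<Omega> \<epsilon>) b1 P_E H_E"
      "reconstruction (harmonic2 \<Omega> (\<lambda>x. matrix_inv (\<mu> x))) b2 P_B H_B"
    and mass: "M_E = harmonic_mass \<Omega> \<epsilon> b1 H_E"
      "M_B = harmonic_mass \<Omega> (\<lambda>x. matrix_inv (\<mu> x)) b2 H_B"
    and actuators: "G_E \<in> carrier_mat b1 mE" "G_B \<in> carrier_mat b2 mB"
    and forcings: "L1_time T b1 g_E" "L1_time T b2 g_B"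
    and current: "L2_time_L2 T \<Omega> j" "j_H = (\<lambda>t. recon_adjoint \<Omega> b1 H_E (j t))"
    and distributed: "distributed_control_operator \<Omega> \<B>" "distributed_control T z"
      "C_Ez = (\<lambda>t. recon_adjoint \<Omega> b1 H_E (\<B> (z t)))"
    and states: "cE0 \<in> carrier_vec b1" "cET \<in> carrier_vec b1"
      "cB0 \<in> carrier_vec b2" "cBT \<in> carrier_vec b2"
  shows "(reachable T b2 mB M_B (\<lambda>a t. G_B *\<^sub>v a t + g_B t) cB0 cBT \<longleftrightarrow>
      M_B *\<^sub>v (cBT - cB0) - time_integral T b2 g_B \<in> mat_range G_B) \<and>
      (reachable T b1 mE M_E (\<lambda>a t. - j_H t - C_Ez t + G_E *\<^sub>v a t + g_E t) cE0 cET \<longleftrightarrow>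
      M_E *\<^sub>v (cET - cE0) + time_integral T b1 j_H + time_integral T b1 C_Ez
        - time_integral T b1 g_E \<in> mat_range G_E) \<and>
      (subspace_dim b1 (P_E ` harmonic1 \<Omega> \<epsilon>) = betti 1 \<Omega>) \<and>
      (subspace_dim b2 (P_B ` harmonic2 \<Omega> (\<lambda>x. matrix_inv (\<mu> x))) = betti 2 \<Omega>) \<and>
      (affine_subspace_of_dim b2
      {c. reachable T b2 mB M_B (\<lambda>a t. G_B *\<^sub>v a t + g_B t) cB0 c} (vec_space.rank b2 G_B)) \<and>
      (affine_subspace_of_dim b1
      {c. reachable T b1 mE M_E (\<lambda>a t. - j_H t - C_Ez t + G_E *\<^sub>v a t + g_E t) cE0 c}
      (vec_space.rank b1 G_E))"
proof (intro conjI)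
  let ?\<nu> = "\<lambda>x. matrix_inv (\<mu> x)"
  have "open \<Omega>" using domain(2) by (simp add: lipschitz_domain_def)
  with domain(1) have \<Omega>: "\<Omega> \<in> lmeasurable" by (rule lmeasurable_open)
  have \<nu>: "material_tensor \<Omega> ?\<nu>" by (rule material_tensor_matrix_inv[OF material(2)])
  have ME: "M_E \<in> carrier_mat b1 b1" and MB: "M_B \<in> carrier_mat b2 b2"
    by (simp_all add: mass harmonic_mass_def)
  have L2_1: "L2 \<Omega> F" if "F \<in> harmonic1 \<Omega> \<epsilon>" for F using that by (simp add: harmonic1_def)
  have L2_2: "L2 \<Omega> F" if "F \<in> harmonic2 \<Omega> ?\<nu>" for F using that by (simp add: harmonic2_def)
  obtain NE where NE: "NE \<in> carrier_mat b1 b1" "M_E * NE = 1\<^sub>m b1" "NE * M_E = 1\<^sub>m b1"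
    using injective_mat_inverse[OF ME]
      harmonic_mass_injective[OF material(1) L2_1 harmonic1_lincomb[OF \<Omega> domain(1) material(1)] periods(1) recon(1)]
    unfolding mass by blast
  obtain NB where NB: "NB \<in> carrier_mat b2 b2" "M_B * NB = 1\<^sub>m b2" "NB * M_B = 1\<^sub>m b2"
    using injective_mat_inverse[OF MB]
      harmonic_mass_injective[OF \<nu> L2_2 harmonic2_lincomb[OF \<Omega> domain(1) \<nu>] periods(2) recon(2)]
    unfolding mass by blast
  have hE: "L2 \<Omega> (H_E (unit_vec b1 i))" if "i < b1" for i
    using recon(1) that L2_1 by (simp add: reconstruction_def)
  have jH: "L1_time T b1 j_H"
    unfolding current(2) by (rule L1_time_recon_adjoint_current[where H = H_E and b = b1, OF \<Omega> current(1) hE])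
  have CE: "L1_time T b1 C_Ez"
    unfolding distributed(3) by (rule L1_time_recon_adjoint_control[where H = H_E and b = b1, OF distributed(1,2) hE])
  \<comment> \<open>All control-independent terms are merged into one forcing, which reduces the
    electric equation to the form of the magnetic one.\<close>
  define f where "f t = - j_H t - C_Ez t + g_E t" for t
  have f: "L1_time T b1 f"
    unfolding f_def by (intro L1_time_add L1_time_minus L1_time_uminus jH CE forcings)
  have fint: "time_integral T b1 f = - time_integral T b1 j_H - time_integral T b1 C_Ez + time_integral T b1 g_E"
    unfolding f_def
    by (simp add: time_integral_add time_integral_minus time_integral_uminus
        L1_time_minus L1_time_uminus jH CE forcings)
  \<comment> \<open>This holds for every function \<open>a\<close>, even with values of the wrong
    length, since the product with \<open>G_E\<close> always has dimension
    \<open>b1\<close>.\<close>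
  have FE: "(\<lambda>a t. - j_H t - C_Ez t + G_E *\<^sub>v a t + g_E t) = (\<lambda>a t. G_E *\<^sub>v a t + f t)"
  proof (intro ext)
    fix a t
    show "- j_H t - C_Ez t + G_E *\<^sub>v a t + g_E t = G_E *\<^sub>v a t + f t"
    using L1_time_dim[OF jH, of t] L1_time_dim[OF CE, of t] L1_time_dim[OF forcings(1), of t] actuators(1)
    by (intro eq_vecI) (simp_all add: f_def)
  qed
  show "reachable T b2 mB M_B (\<lambda>a t. G_B *\<^sub>v a t + g_B t) cB0 cBT \<longleftrightarrow>
      M_B *\<^sub>v (cBT - cB0) - time_integral T b2 g_B \<in> mat_range G_B"
    using reachable_iff[OF T MB NB actuators(2) forcings(2) states(3)] states(4) by simp
  have "M_E *\<^sub>v (cET - cE0) + time_integral T b1 j_H + time_integral T b1 C_Ez - time_integral T b1 g_E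
      = M_E *\<^sub>v (cET - cE0) - time_integral T b1 f"
    unfolding fint using ME by (intro eq_vecI) (simp_all add: time_integral_def)
  then show "reachable T b1 mE M_E (\<lambda>a t. - j_H t - C_Ez t + G_E *\<^sub>v a t + g_E t) cE0 cET \<longleftrightarrow>
      M_E *\<^sub>v (cET - cE0) + time_integral T b1 j_H + time_integral T b1 C_Ez
        - time_integral T b1 g_E \<in> mat_range G_E"
    unfolding FE using reachable_iff[OF T ME NE actuators(1) f states(1)] states(2) by simp
  show "subspace_dim b1 (P_E ` harmonic1 \<Omega> \<epsilon>) = betti 1 \<Omega>"
    using periods(1) subspace_dim_carrier by (simp add: period_map_def betti(1))
  show "subspace_dim b2 (P_B ` harmonic2 \<Omega> ?\<nu>) = betti 2 \<Omega>"
    using periods(2) subspace_dim_carrier by (simp add: period_map_def betti(2))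
  show "affine_subspace_of_dim b2
      {c. reachable T b2 mB M_B (\<lambda>a t. G_B *\<^sub>v a t + g_B t) cB0 c} (vec_space.rank b2 G_B)"
    by (rule reachable_affine_subspace[OF T MB NB actuators(2) forcings(2) states(3)])
  show "affine_subspace_of_dim b1
      {c. reachable T b1 mE M_E (\<lambda>a t. - j_H t - C_Ez t + G_E *\<^sub>v a t + g_E t) cE0 c}
      (vec_space.rank b1 G_E)"
    unfolding FE by (rule reachable_affine_subspace[OF T ME NE actuators(1) f states(1)])
qed

end
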